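(* Let $k,n\in\mathbb N$ with $1\le k\le n$, let $\lambda\vdash n$ and $x\in\lambda$. Then $$d_\lambda(k,x)=\frac{n!}{n-k+1}\left(1-\sum_{l=1}^{k-1}\frac{f_\lambda(l,x)}{f_\lambda}\right)=\frac{\prod_{y\in\lambda}h_\lambda(y)}{n-k+1}\sum_{l=k}^n f_\lambda(l,x).$$
   Context: A partition $\lambda\vdash n$ is identified with its Young diagram $\{(i,j): i\ge1,\ 1\le j\le\lambda_i\}$; $\lambda'$ is the conjugate. The hook length of $x=(i,j)$ is $h_\lambda(x)=(\lambda_i-j)+(\lambda'_j-i)+1$. A tabloid is a bijection $T:\lambda\to\{1,\dots,n\}$; $\operatorname{T}(\lambda)$ is the set of tabloids. A standard Young tableau is a tabloid with entries increasing along rows and down columns; $f_\lambda$ is their number and $f_\lambda(k,x)$ the number with entry $k$ in cell $x$. Order cells by $(i,j)\prec(k,l)$ iff $j<l$, or $j=l$ and $i<k$; list them $z_1\prec\dots\prec z_n$. Novelli--Pak--Stoyanovskii sorting of $T$: $T_{z_n}:=T$; for $m=n-1,\dots,1$, $T_{z_m}$ is obtained from $T_{z_{m+1}}$ by the slide at $z_m$: the entry in $z_m$ is repeatedly exchanged with the smaller of the entries in its current right and bottom neighbours as long as that entry is smaller than it. Drop function: $d_\lambda(k,x)$ is the number of $T\in\operatorname{T}(\lambda)$ such that, with $z$ the cell with $T(z)=k$, one has $T_z(x)=k$ (the entry $k$ is moved to $x$ by its own slide). *)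

theory Defs
  imports Complex_Main "HOL-Library.Product_Lexorder"
begin

type_synonym cell = "nat \<times> nat"
type_synonym filling = "cell \<Rightarrow> nat"

text \<open>A partition of n: a weakly decreasing list of positive parts summing to n.
  Rows and columns are indexed from 1; part lam_i is lam ! (i - 1).\<close>
definition is_partition :: "nat \<Rightarrow> nat list \<Rightarrow> bool" where
  "is_partition n lam \<longleftrightarrow> sorted_wrt (\<ge>) lam \<and> (\<forall>p \<in> set lam. 0 < p) \<and> sum_list lam = n"

definition part :: "nat list \<Rightarrow> nat \<Rightarrow> nat" where
  "part lam i = (if 1 \<le> i \<and> i \<le> length lam then lam ! (i - 1) else 0)"

definition diagram :: "nat list \<Rightarrow> cell set" where
  "diagram lam = {(i, j). 1 \<le> i \<and> 1 \<le> j \<and> j \<le> part lam i}"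

definition conj_part :: "nat list \<Rightarrow> nat \<Rightarrow> nat" where
  "conj_part lam j = card {i. 1 \<le> i \<and> i \<le> length lam \<and> j \<le> part lam i}"

definition hook :: "nat list \<Rightarrow> cell \<Rightarrow> nat" where
  "hook lam x = (part lam (fst x) - snd x) + (conj_part lam (snd x) - fst x) + 1"

definition tabloids :: "nat list \<Rightarrow> filling set" where
  "tabloids lam = {T. bij_betw T (diagram lam) {1..sum_list lam} \<and> (\<forall>x. x \<notin> diagram lam \<longrightarrow> T x = 0)}"

definition syt :: "nat list \<Rightarrow> filling set" where
  "syt lam = {T \<in> tabloids lam.
      (\<forall>i j. (i, j) \<in> diagram lam \<and> (i, Suc j) \<in> diagram lam \<longrightarrow> T (i, j) < T (i, Suc j)) \<and>
      (\<forall>i j. (i, j) \<in> diagram lam \<and> (Suc i, j) \<in> diagram lam \<longrightarrow> T (i, j) < T (Suc i, j))}"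

definition f_syt :: "nat list \<Rightarrow> nat" where
  "f_syt lam = card (syt lam)"

definition f_syt_at :: "nat list \<Rightarrow> nat \<Rightarrow> cell \<Rightarrow> nat" where
  "f_syt_at lam k x = card {T \<in> syt lam. T x = k}"

definition cells :: "nat list \<Rightarrow> cell list" where
  "cells lam = map (\<lambda>(j, i). (i, j)) (sorted_list_of_set ((\<lambda>(i, j). (j, i)) ` diagram lam))"

text \<open>One slide: the entry at p is repeatedly exchanged with the smaller of the entries
  in its right and bottom neighbours, as long as that entry is smaller.
  The fuel argument bounds the number of exchanges (each exchange moves to a new cell,
  so card of the diagram steps always suffice).\<close>
fun slide_aux :: "cell set \<Rightarrow> nat \<Rightarrow> filling \<Rightarrow> cell \<Rightarrow> filling" where
  "slide_aux D 0 T p = T"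
| "slide_aux D (Suc f) T p =
     (let r = (fst p, Suc (snd p)); b = (Suc (fst p), snd p);
          cr = (r \<in> D \<and> T r < T p); cb = (b \<in> D \<and> T b < T p)
      in if \<not> cr \<and> \<not> cb then T
         else let q = (if cr \<and> cb then (if T r < T b then r else b) else if cr then r else b)
              in slide_aux D f (T(p := T q, q := T p)) q)"

definition slide :: "nat list \<Rightarrow> filling \<Rightarrow> cell \<Rightarrow> filling" where
  "slide lam T p = slide_aux (diagram lam) (card (diagram lam)) T p"

text \<open>NPS stage: for the cell z_{q+1} = cells ! q, T_{z_{q+1}} is obtained from T by
  the slides at z_{n-1}, ..., z_{q+1} (in this order).\<close>
definition nps_stage :: "nat list \<Rightarrow> filling \<Rightarrow> nat \<Rightarrow> filling" where
  "nps_stage lam T q = fold (\<lambda>z U. slide lam U z) (rev (butlast (drop q (cells lam)))) T"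

definition nps_at :: "nat list \<Rightarrow> filling \<Rightarrow> cell \<Rightarrow> filling" where
  "nps_at lam T z = nps_stage lam T (THE q. q < length (cells lam) \<and> cells lam ! q = z)"

definition drop_fun :: "nat list \<Rightarrow> nat \<Rightarrow> cell \<Rightarrow> nat" where
  "drop_fun lam k x = card {T \<in> tabloids lam.
      let z = (THE z. z \<in> diagram lam \<and> T z = k) in nps_at lam T z x = k}"

end

theory Submission
  imports Defs "HOL-Library.FuncSet" "HOL-Combinatorics.Permutations"
begin

text \<open>Sorting is combined with the Novelli-Pak-Stoyanovskii bookkeeping: each slide also updates an
  integer hook function with values between minus leg and arm. One such step is a bijection
  between explicitly described sets of pairs (filling, hook function), so every standard Young
  tableau arises from exactly as many tabloids as there are hook functions, namely the product
  of the hook lengths. This contains the hook length formula.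

  For the drop function call an entry large if it is at least k. The slide of a large entry first
  passes entries below k, and what it does afterwards only permutes large entries; the slide of a
  small entry moves no large one. Hence the set of processed cells with large entries grows by
  exactly one cell per large entry, namely the cell to which this entry would be dropped if it were
  k. So x ends up in that set for exactly one large entry if the sorted tableau has a large entry
  in x, and for none otherwise. Since the n - k + 1 large entries are interchangeable,
  (n - k + 1) d(k, x) counts the tabloids whose sorted tableau has an entry at least k in x.\<close>

text \<open>The obstacle is invertibility: after a slide from \<open>(i0, j0)\<close> the filling no
  longer shows where the slide ended. \<open>bump\<close> stores the end \<open>(p, e)\<close> as
  the value \<open>e - j0\<close> in row \<open>p\<close> of column \<open>j0\<close> and makes room
  by moving the values of rows \<open>i0 + 1\<close> to \<open>p\<close> one row up. The decrease by
  one that goes with this matches the leg, which is one longer in the row above, so the bounds are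
  kept; the marked cell \<open>(row, j0 + value)\<close> moves up along its diagonal. As every
  nonnegative value marks a possible end, the true one must be recognised: reverse paths may merge
  but not cross, and a new slide cannot pass below the reverse path of an older mark
  (\<open>above_candidate\<close>). Conversely, undoing the topmost path keeps the other marks
  admissible (\<open>T_inv\<close>).

  Exchanging two large values can change the routes of slides, so the interchange of large entries
  needs an argument: sorting commutes with replacing every large entry by k. The resulting ties are
  harmless. Equal entries are not exchanged, and once the moving entry and its neighbours are large,
  so is everything to their south-east.\<close>

section \<open>Slide paths\<close>

text \<open>The path of an entry a starting in the cell (i0, j0) and ending in row p; it occupies the columns
  from s i to s (i + 1) of row i. The value of T in the starting cell is irrelevant.\<close>

definition slide_path ::
  "cell set \<Rightarrow> filling \<Rightarrow> nat \<Rightarrow> nat \<Rightarrow> nat \<Rightarrow> nat \<Rightarrow> (nat \<Rightarrow> nat) \<Rightarrow> bool" where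
  "slide_path D T a i0 j0 p s \<longleftrightarrow> i0 \<le> p \<and> s i0 = j0 \<and>
     (\<forall>i. i0 \<le> i \<and> i \<le> p \<longrightarrow> s i \<le> s (Suc i)) \<and>
     (\<forall>i j. i0 \<le> i \<and> i \<le> p \<and> s i \<le> j \<and> j < s (Suc i) \<longrightarrow>
        (i, Suc j) \<in> D \<and> T (i, Suc j) < a \<and> ((Suc i, j) \<in> D \<longrightarrow> T (i, Suc j) < T (Suc i, j))) \<and>
     (\<forall>i. i0 \<le> i \<and> i < p \<longrightarrow>
        (Suc i, s (Suc i)) \<in> D \<and> T (Suc i, s (Suc i)) < a \<and>
        ((i, Suc (s (Suc i))) \<in> D \<longrightarrow> T (Suc i, s (Suc i)) < T (i, Suc (s (Suc i))))) \<and>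
     ((p, Suc (s (Suc p))) \<in> D \<longrightarrow> \<not> T (p, Suc (s (Suc p))) < a) \<and>
     ((Suc p, s (Suc p)) \<in> D \<longrightarrow> \<not> T (Suc p, s (Suc p)) < a)"

definition on_path :: "nat \<Rightarrow> nat \<Rightarrow> (nat \<Rightarrow> nat) \<Rightarrow> cell \<Rightarrow> bool" where
  "on_path i0 p s c \<longleftrightarrow> i0 \<le> fst c \<and> fst c \<le> p \<and> s (fst c) \<le> snd c \<and> snd c \<le> s (Suc (fst c))"

text \<open>The net effect of all exchanges of one slide. The path leaves row \<open>i\<close>
  downwards in column \<open>s (Suc i)\<close>, so this cell takes its entry from below and the
  earlier cells of the row take theirs from the right.\<close>

definition shift_path :: "nat \<Rightarrow> nat \<Rightarrow> (nat \<Rightarrow> nat) \<Rightarrow> filling \<Rightarrow> filling" where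
  "shift_path i0 p s T = (\<lambda>(i, j).
     if on_path i0 p s (i, j)
     then if j < s (Suc i) then T (i, Suc j) else if i < p then T (Suc i, j) else T (i0, s i0)
     else T (i, j))"

definition unshift_path :: "nat \<Rightarrow> nat \<Rightarrow> (nat \<Rightarrow> nat) \<Rightarrow> filling \<Rightarrow> filling" where
  "unshift_path i0 p s T = (\<lambda>(i, j).
     if on_path i0 p s (i, j)
     then if s i < j then T (i, j - 1) else if i0 < i then T (i - 1, j) else T (p, s (Suc p))
     else T (i, j))"

lemma slide_pathD:
  assumes "slide_path D T a i0 j0 p s"
  shows "i0 \<le> p" "s i0 = j0"
    "\<And>i. i0 \<le> i \<Longrightarrow> i \<le> p \<Longrightarrow> s i \<le> s (Suc i)"
    "\<And>i j. i0 \<le> i \<Longrightarrow> i \<le> p \<Longrightarrow> s i \<le> j \<Longrightarrow> j < s (Suc i) \<Longrightarrow> (i, Suc j) \<in> D"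
    "\<And>i j. i0 \<le> i \<Longrightarrow> i \<le> p \<Longrightarrow> s i \<le> j \<Longrightarrow> j < s (Suc i) \<Longrightarrow> T (i, Suc j) < a"
    "\<And>i j. i0 \<le> i \<Longrightarrow> i \<le> p \<Longrightarrow> s i \<le> j \<Longrightarrow> j < s (Suc i) \<Longrightarrow> (Suc i, j) \<in> D
        \<Longrightarrow> T (i, Suc j) < T (Suc i, j)"
    "\<And>i. i0 \<le> i \<Longrightarrow> i < p \<Longrightarrow> (Suc i, s (Suc i)) \<in> D"
    "\<And>i. i0 \<le> i \<Longrightarrow> i < p \<Longrightarrow> T (Suc i, s (Suc i)) < a"
    "\<And>i. i0 \<le> i \<Longrightarrow> i < p \<Longrightarrow> (i, Suc (s (Suc i))) \<in> D
        \<Longrightarrow> T (Suc i, s (Suc i)) < T (i, Suc (s (Suc i)))"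
    "(p, Suc (s (Suc p))) \<in> D \<Longrightarrow> \<not> T (p, Suc (s (Suc p))) < a"
    "(Suc p, s (Suc p)) \<in> D \<Longrightarrow> \<not> T (Suc p, s (Suc p)) < a"
  using assms unfolding slide_path_def by blast+

lemma path_mono:
  assumes "\<And>i. i0 \<le> i \<Longrightarrow> i \<le> p \<Longrightarrow> s i \<le> s (Suc i)"
    and "i0 \<le> i" "i \<le> i'" "i' \<le> Suc p"
  shows "s i \<le> (s i' :: nat)"
  using assms(3,4)
proof (induction i' rule: dec_induct)
  case (step m)
  then show ?case using assms(1)[of m] assms(2) by simp
qed simp

text \<open>Induction on the fuel, whose bound is the number of exchanges. After one exchange the
  rest of the path is a slide path of the same entry in the new filling, since all later comparisons
  avoid the two exchanged cells.\<close>

lemma slide_aux_eq_shift_path: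
  assumes "slide_path D T (T (i0, j0)) i0 j0 p s" "(p - i0) + (s (Suc p) - j0) \<le> f"
  shows "slide_aux D f T (i0, j0) = shift_path i0 p s T"
  using assms
proof (induction f arbitrary: T i0 j0 s)
  case 0
  note P = slide_pathD[OF 0(1)]
  have "p = i0" using 0(2) P(1) by simp
  then have "p = i0" "s (Suc i0) = j0" "s i0 = j0"
    using 0(2) P(2) P(3)[of i0] by auto
  then show ?case by (auto simp: fun_eq_iff shift_path_def on_path_def)
next
  case (Suc f)
  note P = slide_pathD[OF Suc.prems(1)]
  let ?a = "T (i0, j0)" and ?r = "(i0, Suc j0)" and ?b = "(Suc i0, j0)"
  have mono: "s i \<le> s i'" if "i0 \<le> i" "i \<le> i'" "i' \<le> Suc p" for i i'
    using path_mono[of i0 p s] P(3) that by blast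
  have "s i0 \<le> s (Suc i0)" using P(1,3) by simp
  then consider (R) "j0 < s (Suc i0)" | (B) "s (Suc i0) = j0" "i0 < p" | (S) "s (Suc i0) = j0" "i0 = p"
    using P(1,2) by linarith
  then show ?case
  proof cases
    case R
    let ?T = "T((i0, j0) := T ?r, ?r := ?a)" and ?s = "s(i0 := Suc j0)"
    have r: "?r \<in> D" "T ?r < ?a" "?b \<in> D \<Longrightarrow> T ?r < T ?b"
      using P(4)[of i0 j0] P(5)[of i0 j0] P(6)[of i0 j0] R P(1,2) by auto
    have ge: "Suc j0 \<le> s i" if "Suc i0 \<le> i" "i \<le> Suc p" for i
      using mono[of "Suc i0" i] that R by simp
    have "slide_path D ?T (?T ?r) i0 (Suc j0) p ?s"
      unfolding slide_path_def
    proof (intro conjI allI impI; (elim conjE)?)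
      show "i0 \<le> p" "?s i0 = Suc j0" using P(1) by auto
    next
      fix i assume "i0 \<le> i" "i \<le> p"
      then show "?s i \<le> ?s (Suc i)" using P(3)[of i] R by auto
    next
      fix i j assume h: "i0 \<le> i" "i \<le> p" "?s i \<le> j" "j < ?s (Suc i)"
      then have h': "s i \<le> j" "j < s (Suc i)" using P(2) by (auto split: if_splits)
      have j: "Suc j0 \<le> j" using h ge[of i] by (auto split: if_splits)
      show "(i, Suc j) \<in> D" using P(4) h h' by blast
      show "?T (i, Suc j) < ?T ?r" using P(5)[of i j] h h' j by auto
      show "?T (i, Suc j) < ?T (Suc i, j)" if "(Suc i, j) \<in> D"
        using P(6)[of i j] h h' j that by auto
    next
      fix i assume h: "i0 \<le> i" "i < p"
      show "(Suc i, ?s (Suc i)) \<in> D" using P(7) h by auto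
      show "?T (Suc i, ?s (Suc i)) < ?T ?r" using P(8) h by auto
      show "?T (Suc i, ?s (Suc i)) < ?T (i, Suc (?s (Suc i)))" if "(i, Suc (?s (Suc i))) \<in> D"
        using P(9) h that ge[of "Suc i"] by auto
    next
      assume "(p, Suc (?s (Suc p))) \<in> D"
      then show "\<not> ?T (p, Suc (?s (Suc p))) < ?T ?r" using P(1,10) ge[of "Suc p"] by auto
    next
      assume "(Suc p, ?s (Suc p)) \<in> D"
      then show "\<not> ?T (Suc p, ?s (Suc p)) < ?T ?r" using P(1,11) by auto
    qed
    moreover have "(p - i0) + (?s (Suc p) - Suc j0) \<le> f"
      using Suc.prems(2) ge[of "Suc p"] P(1) by auto
    ultimately have "slide_aux D f ?T ?r = shift_path i0 p ?s ?T"
      by (rule Suc.IH)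
    also have "\<dots> = shift_path i0 p s T"
    proof
      fix c show "shift_path i0 p ?s ?T c = shift_path i0 p s T c"
        using R P(1,2) ge[of "fst c"]
        by (cases c, cases "c = (i0, j0)") (auto simp: shift_path_def on_path_def)
    qed
    finally show ?thesis using r by (simp add: Let_def)
  next
    case B
    let ?T = "T((i0, j0) := T ?b, ?b := ?a)"
    have b: "?b \<in> D" "T ?b < ?a" "?r \<in> D \<Longrightarrow> T ?b < T ?r"
      using P(7)[of i0] P(8)[of i0] P(9)[of i0] B by auto
    have ge: "j0 \<le> s i" if "Suc i0 \<le> i" "i \<le> Suc p" for i
      using mono[of "Suc i0" i] that B by simp
    have "slide_path D ?T (?T ?b) (Suc i0) j0 p s"
      unfolding slide_path_def
    proof (intro conjI allI impI; (elim conjE)?)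
      show "Suc i0 \<le> p" "s (Suc i0) = j0" using B by auto
    next
      fix i assume "Suc i0 \<le> i" "i \<le> p"
      then show "s i \<le> s (Suc i)" using P(3)[of i] by auto
    next
      fix i j assume h: "Suc i0 \<le> i" "i \<le> p" "s i \<le> j" "j < s (Suc i)"
      have j: "j0 \<le> j" using h ge[of i] by auto
      show "(i, Suc j) \<in> D" using P(4) h by auto
      show "?T (i, Suc j) < ?T ?b" using P(5)[of i j] h j by auto
      show "?T (i, Suc j) < ?T (Suc i, j)" if "(Suc i, j) \<in> D"
        using P(6)[of i j] h j that by auto
    next
      fix i assume h: "Suc i0 \<le> i" "i < p"
      show "(Suc i, s (Suc i)) \<in> D" using P(7) h by auto
      show "?T (Suc i, s (Suc i)) < ?T ?b" using P(8)[of i] h by auto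
      show "?T (Suc i, s (Suc i)) < ?T (i, Suc (s (Suc i)))" if "(i, Suc (s (Suc i))) \<in> D"
        using P(9) h that ge[of "Suc i"] by auto
    next
      assume "(p, Suc (s (Suc p))) \<in> D"
      then show "\<not> ?T (p, Suc (s (Suc p))) < ?T ?b" using B P(10) ge[of "Suc p"] by auto
    next
      assume "(Suc p, s (Suc p)) \<in> D"
      then show "\<not> ?T (Suc p, s (Suc p)) < ?T ?b" using B P(11) by auto
    qed
    moreover have "(p - Suc i0) + (s (Suc p) - j0) \<le> f"
      using Suc.prems(2) B by auto
    ultimately have "slide_aux D f ?T ?b = shift_path (Suc i0) p s ?T"
      by (rule Suc.IH)
    also have "\<dots> = shift_path i0 p s T"
    proof
      fix c :: cell
      obtain i j where c: "c = (i, j)" by fastforce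
      consider "i = i0" | "i = Suc i0" | "Suc i0 < i" | "i < i0" by linarith
      then show "shift_path (Suc i0) p s ?T c = shift_path i0 p s T c"
        using B P(2) P(3)[of "Suc i0"] unfolding c by cases (auto simp: shift_path_def on_path_def)
    qed
    finally show ?thesis using b by (auto simp: Let_def dest: less_asym)
  next
    case S
    have "shift_path i0 p s T = T"
      using S P(2) by (auto simp: fun_eq_iff shift_path_def on_path_def)
    then show ?thesis using P(10,11) S by (auto simp: Let_def)
  qed
qed

text \<open>The moving entry \<open>a\<close> is a parameter of its own, so \<open>T\<close> stays
  fixed while the induction moves the starting cell. It ends because \<open>i0 + j0\<close> is
  bounded on a finite set.\<close>

lemma slide_path_exists:
  assumes "inj_on T D" "finite D" "(i0, j0) \<in> D"
  shows "\<exists>p s. slide_path D T a i0 j0 p s"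
proof -
  obtain K where K: "\<And>i j. (i, j) \<in> D \<Longrightarrow> i + j \<le> K"
    using finite_nat_set_iff_bounded_le[of "(\<lambda>(i, j). i + j) ` D"] assms(2) by force
  from assms(3) show ?thesis
  proof (induction "K - (i0 + j0)" arbitrary: i0 j0 rule: less_induct)
    case less
    let ?r = "(i0, Suc j0)" and ?b = "(Suc i0, j0)"
    consider (R) "?r \<in> D" "T ?r < a" "?b \<in> D \<Longrightarrow> T ?r < T ?b"
      | (B) "?b \<in> D" "T ?b < a" "?r \<in> D \<Longrightarrow> T ?b < T ?r"
      | (S) "?r \<in> D \<Longrightarrow> \<not> T ?r < a" "?b \<in> D \<Longrightarrow> \<not> T ?b < a"
      using inj_onD[OF assms(1), of ?r ?b] by fastforce
    then show ?case
    proof cases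
      case R
      have "K - (i0 + Suc j0) < K - (i0 + j0)" using K[OF R(1)] by simp
      from less.hyps[OF this R(1)] obtain p s where P: "slide_path D T a i0 (Suc j0) p s" by blast
      \<comment> \<open>The prolonged path enters row \<open>i0\<close> one column further left; the
        later entry columns are kept.\<close>
      have "slide_path D T a i0 j0 p (s(i0 := j0))"
        unfolding slide_path_def
      proof (intro conjI allI impI; (elim conjE)?)
        note P' = slide_pathD[OF P]
        show "i0 \<le> p" "(s(i0 := j0)) i0 = j0" using P' by auto
        fix i j assume h: "i0 \<le> i" "i \<le> p" "(s(i0 := j0)) i \<le> j" "j < (s(i0 := j0)) (Suc i)"
        then have "i = i0 \<and> j = j0 \<or> s i \<le> j \<and> j < s (Suc i)" using P'(2) by (auto split: if_splits)
        then show "(i, Suc j) \<in> D" "T (i, Suc j) < a" "(Suc i, j) \<in> D \<Longrightarrow> T (i, Suc j) < T (Suc i, j)"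
          using P'(4)[of i j] P'(5)[of i j] P'(6)[of i j] R h by auto
      next
        note P' = slide_pathD[OF P]
        fix i assume h: "i0 \<le> i" "i \<le> p"
        show "(s(i0 := j0)) i \<le> (s(i0 := j0)) (Suc i)" using P'(1,2) P'(3)[of i] h by auto
      next
        note P' = slide_pathD[OF P]
        fix i assume h: "i0 \<le> i" "i < p"
        show "(Suc i, (s(i0 := j0)) (Suc i)) \<in> D" "T (Suc i, (s(i0 := j0)) (Suc i)) < a"
          using P'(7)[of i] P'(8)[of i] h by auto
        show "T (Suc i, (s(i0 := j0)) (Suc i)) < T (i, Suc ((s(i0 := j0)) (Suc i)))"
          if "(i, Suc ((s(i0 := j0)) (Suc i))) \<in> D"
          using P'(9)[of i] h that by auto
      next
        note P' = slide_pathD[OF P]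
        assume "(p, Suc ((s(i0 := j0)) (Suc p))) \<in> D"
        then show "\<not> T (p, Suc ((s(i0 := j0)) (Suc p))) < a" using P'(1,10) by auto
      next
        note P' = slide_pathD[OF P]
        assume "(Suc p, (s(i0 := j0)) (Suc p)) \<in> D"
        then show "\<not> T (Suc p, (s(i0 := j0)) (Suc p)) < a" using P'(1,11) by auto
      qed
      then show ?thesis by blast
    next
      case B
      have "K - (Suc i0 + j0) < K - (i0 + j0)" using K[OF B(1)] by simp
      from less.hyps[OF this B(1)] obtain p s where P: "slide_path D T a (Suc i0) j0 p s" by blast
      note P' = slide_pathD[OF P]
      have "slide_path D T a i0 j0 p (s(i0 := j0))"
        unfolding slide_path_def
      proof (intro conjI allI impI; (elim conjE)?)
        show "i0 \<le> p" "(s(i0 := j0)) i0 = j0" using P' by auto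
        fix i assume "i0 \<le> i" "i \<le> p"
        then show "(s(i0 := j0)) i \<le> (s(i0 := j0)) (Suc i)" using P'(2) P'(3)[of i] by auto
      next
        fix i j assume h: "i0 \<le> i" "i \<le> p" "(s(i0 := j0)) i \<le> j" "j < (s(i0 := j0)) (Suc i)"
        then have "Suc i0 \<le> i \<and> s i \<le> j \<and> j < s (Suc i)" using P'(2) by (auto split: if_splits)
        then show "(i, Suc j) \<in> D" "T (i, Suc j) < a" "(Suc i, j) \<in> D \<Longrightarrow> T (i, Suc j) < T (Suc i, j)"
          using P'(4)[of i j] P'(5)[of i j] P'(6)[of i j] h by auto
      next
        fix i assume h: "i0 \<le> i" "i < p"
        show "(Suc i, (s(i0 := j0)) (Suc i)) \<in> D" "T (Suc i, (s(i0 := j0)) (Suc i)) < a"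
          using P'(2) P'(7)[of i] P'(8)[of i] h B by (cases "i = i0"; simp)+
        show "T (Suc i, (s(i0 := j0)) (Suc i)) < T (i, Suc ((s(i0 := j0)) (Suc i)))"
          if "(i, Suc ((s(i0 := j0)) (Suc i))) \<in> D"
          using P'(2) P'(9)[of i] h B that by (cases "i = i0"; simp)
      qed (use P' in auto)
      then show ?thesis by blast
    next
      case S
      then have "slide_path D T a i0 j0 i0 (\<lambda>_. j0)"
        unfolding slide_path_def by auto
      then show ?thesis by blast
    qed
  qed
qed

text \<open>At a common cell the conditions for going right, going down and stopping exclude each
  other: \<open>right\<close> rules out that one path goes right while the other turns down or
  stops, \<open>down\<close> that one stops while the other goes down.\<close>

lemma slide_path_unique:
  assumes "slide_path D T a i0 j0 p s" "slide_path D T a i0 j0 p' s'"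
  shows "p = p' \<and> (\<forall>i. i0 \<le> i \<and> i \<le> Suc p \<longrightarrow> s i = s' i)"
proof -
  have right: False
    if P: "slide_path D T a i0 j0 p s" and P': "slide_path D T a i0 j0 p' s'"
      and h: "i0 \<le> i" "i \<le> p" "i \<le> p'" "s i = s' i" "s (Suc i) < s' (Suc i)" for p s p' s' i
  proof -
    have j: "s' i \<le> s (Suc i)" using slide_pathD(3)[OF P, of i] h by simp
    note R = slide_pathD(4,5,6)[OF P' h(1,3) j h(5)]
    show False
    proof (cases "i = p")
      case True
      then show False using R slide_pathD(10)[OF P] by simp
    next
      case False
      then have lt: "i < p" using h(2) by simp
      show False using R(3) slide_pathD(7)[OF P h(1) lt] slide_pathD(9)[OF P h(1) lt R(1)] by simp
    qed
  qed
  have same: "s i = s' i" if "i0 \<le> i" "i \<le> Suc p" "i \<le> Suc p'" for i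
    using that
  proof (induction i rule: dec_induct)
    case base
    then show ?case using assms[THEN slide_pathD(2)] by simp
  next
    case (step i)
    then show ?case
      using right[OF assms, of i] right[OF assms(2,1), of i] by (metis Suc_leD Suc_le_mono linorder_neqE_nat)
  qed
  have down: False
    if P: "slide_path D T a i0 j0 p s" and P': "slide_path D T a i0 j0 p' s'"
      and h: "p < p'" "s (Suc p) = s' (Suc p)" for p s p' s'
    using slide_pathD(7,8)[OF P', of p] slide_pathD(1,11)[OF P] h by simp
  have "p = p'"
    using down[OF assms] down[OF assms(2,1)] same[of "Suc p"] same[of "Suc p'"]
      assms[THEN slide_pathD(1)]
    by (metis le_SucI linorder_neqE_nat less_imp_le Suc_le_mono order_refl)
  then show ?thesis using same by simp
qed

section \<open>Shapes and tabloids\<close>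

locale partition =
  fixes lam :: "nat list" and n :: nat
  assumes is_part: "is_partition n lam"
begin

abbreviation "D \<equiv> diagram lam"

lemma mem_D: "(i, j) \<in> D \<longleftrightarrow> 1 \<le> i \<and> 1 \<le> j \<and> j \<le> part lam i"
  by (simp add: diagram_def)

lemma part_antimono: "1 \<le> i \<Longrightarrow> i \<le> i' \<Longrightarrow> part lam i' \<le> part lam i"
  using is_part sorted_wrt_nth_less[of "(\<ge>)" lam "i - 1" "i' - 1"]
  by (cases "i = i'") (auto simp: Defs.part_def is_partition_def)

lemma D_mono: "(i', j') \<in> D \<Longrightarrow> 1 \<le> i \<Longrightarrow> i \<le> i' \<Longrightarrow> 1 \<le> j \<Longrightarrow> j \<le> j' \<Longrightarrow> (i, j) \<in> D"
  using part_antimono[of i i'] by (simp add: mem_D)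

lemma D_eq_Sigma: "D = (SIGMA i:{1..length lam}. {1..part lam i})"
  by (auto simp: mem_D Defs.part_def split: if_splits)

lemma finite_D [simp]: "finite D"
  by (simp add: D_eq_Sigma)

lemma card_D: "card D = n"
proof -
  have "card D = (\<Sum>i = 1..length lam. part lam i)"
    by (simp add: D_eq_Sigma)
  also have "\<dots> = (\<Sum>i < length lam. lam ! i)"
    by (rule sum.reindex_bij_witness[of _ Suc "\<lambda>i. i - 1"]) (auto simp: Defs.part_def)
  also have "\<dots> = n"
    using is_part by (simp add: is_partition_def sum_list_sum_nth atLeast0LessThan)
  finally show ?thesis .
qed

text \<open>The rows counted by \<open>conj_part\<close> form an initial segment because
  \<open>D\<close> is closed upwards, so their number is the last of them.\<close>

lemma mem_D_column: "1 \<le> j \<Longrightarrow> (i, j) \<in> D \<longleftrightarrow> 1 \<le> i \<and> i \<le> conj_part lam j"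
proof -
  assume j: "1 \<le> j"
  define S where "S = {i. 1 \<le> i \<and> i \<le> length lam \<and> j \<le> part lam i}"
  have fin: "finite S" by (simp add: S_def)
  have mem: "i \<in> S \<longleftrightarrow> (i, j) \<in> D" for i
    using j by (auto simp: S_def mem_D Defs.part_def split: if_splits)
  have "S = {1..card S}"
  proof (cases "S = {}")
    case False
    have M: "(Max S, j) \<in> D" using Max_in[OF fin False] mem by simp
    have "i \<in> S" if "1 \<le> i" "i \<le> Max S" for i
      using D_mono[OF M that j] by (simp add: mem)
    moreover have "1 \<le> i" if "i \<in> S" for i using that by (simp add: S_def)
    ultimately have "S = {1..Max S}" using Max_ge[OF fin] by (intro set_eqI) (meson atLeastAtMost_iff)
    then show ?thesis by (metis card_atLeastAtMost diff_Suc_1)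
  qed simp
  then have "i \<in> S \<longleftrightarrow> 1 \<le> i \<and> i \<le> card S" by (metis atLeastAtMost_iff)
  moreover have "conj_part lam j = card S" by (simp add: conj_part_def S_def)
  ultimately show ?thesis by (simp add: mem)
qed

text \<open>Integers rather than naturals, so that \<open>{- leg c..arm c}\<close> is an interval
  with \<open>hook lam c\<close> elements.\<close>

definition arm :: "cell \<Rightarrow> int" where "arm c = int (part lam (fst c)) - int (snd c)"
definition leg :: "cell \<Rightarrow> int" where "leg c = int (conj_part lam (snd c)) - int (fst c)"

lemma int_hook: "c \<in> D \<Longrightarrow> int (hook lam c) = arm c + leg c + 1"
  using mem_D_column[of "snd c" "fst c"]
  by (cases c) (auto simp: hook_def arm_def leg_def mem_D of_nat_diff)

text \<open>The cells processed before the slide at (i0, j0).\<close>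
definition after :: "nat \<Rightarrow> nat \<Rightarrow> cell set" where
  "after i0 j0 = {(i, j). (i, j) \<in> D \<and> (j0 < j \<or> j = j0 \<and> i0 < i)}"

definition increasing_on :: "cell set \<Rightarrow> filling \<Rightarrow> bool" where
  "increasing_on A T \<longleftrightarrow>
     (\<forall>i j. (i, j) \<in> A \<and> (i, Suc j) \<in> A \<longrightarrow> T (i, j) < T (i, Suc j)) \<and>
     (\<forall>i j. (i, j) \<in> A \<and> (Suc i, j) \<in> A \<longrightarrow> T (i, j) < T (Suc i, j))"

lemma increasing_onD:
  assumes "increasing_on A T"
  shows "(i, j) \<in> A \<Longrightarrow> (i, Suc j) \<in> A \<Longrightarrow> T (i, j) < T (i, Suc j)"
    and "(i, j) \<in> A \<Longrightarrow> (Suc i, j) \<in> A \<Longrightarrow> T (i, j) < T (Suc i, j)"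
  using assms unfolding increasing_on_def by blast+

lemma increasing_on_mono:
  assumes "increasing_on A T" "i \<le> i'" "j \<le> j'"
    and "\<And>k l. i \<le> k \<Longrightarrow> k \<le> i' \<Longrightarrow> j \<le> l \<Longrightarrow> l \<le> j' \<Longrightarrow> (k, l) \<in> A"
  shows "T (i, j) \<le> T (i', j')"
proof -
  note inc = increasing_onD[OF assms(1)]
  have "T (i, j) \<le> T (k, j)" if "i \<le> k" "k \<le> i'" for k
    using that
  proof (induction k rule: dec_induct)
    case (step k)
    then show ?case using inc(2)[of k j] assms(4)[of k j] assms(4)[of "Suc k" j] assms(3) by simp
  qed simp
  moreover have "T (i', j) \<le> T (i', l)" if "j \<le> l" "l \<le> j'" for l
    using that
  proof (induction l rule: dec_induct)
    case (step l)
    then show ?case using inc(1)[of i' l] assms(4)[of i' l] assms(4)[of i' "Suc l"] assms(2) by simp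
  qed simp
  ultimately show ?thesis using assms(2,3) by (meson le_trans order_refl)
qed

lemma increasing_on_after_mono:
  assumes "increasing_on (after m j0) T" "(i, j) \<in> after m j0" "(i', j') \<in> D" "i \<le> i'" "j \<le> j'"
  shows "T (i, j) \<le> T (i', j')"
proof (rule increasing_on_mono[OF assms(1,4,5)])
  fix k l assume "i \<le> k" "k \<le> i'" "j \<le> l" "l \<le> j'"
  then show "(k, l) \<in> after m j0"
    using D_mono[OF assms(3), of k l] assms(2) by (auto simp: after_def mem_D)
qed

lemma tabloids_iff:
  "T \<in> tabloids lam \<longleftrightarrow> bij_betw T D {1..n} \<and> (\<forall>c. c \<notin> D \<longrightarrow> T c = 0)"
  using is_part by (simp add: tabloids_def is_partition_def)

lemma tabloid_inj: "T \<in> tabloids lam \<Longrightarrow> inj_on T D"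
  by (simp add: tabloids_iff bij_betw_def)

lemma syt_eq: "syt lam = {T \<in> tabloids lam. increasing_on D T}"
  by (simp add: syt_def increasing_on_def)

lemma tabloid_swap:
  assumes "T \<in> tabloids lam" "c \<in> D" "d \<in> D"
  shows "T(c := T d, d := T c) \<in> tabloids lam"
proof -
  have *: "T(c := T d, d := T c) = T \<circ> transpose c d"
    by (auto simp: fun_eq_iff transpose_def)
  have "bij_betw (T \<circ> transpose c d) D {1..n}"
    using assms by (intro bij_betw_trans[of "transpose c d" D D]) (auto simp: tabloids_iff)
  then show ?thesis using assms unfolding * by (auto simp: tabloids_iff transpose_def)
qed

lemma slide_aux_tabloid:
  "T \<in> tabloids lam \<Longrightarrow> c \<in> D \<Longrightarrow> slide_aux D f T c \<in> tabloids lam"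
proof (induction f arbitrary: T c)
  case (Suc f)
  then show ?case by (simp add: Let_def tabloid_swap del: fun_upd_apply)
qed simp

lemma slide_tabloid: "T \<in> tabloids lam \<Longrightarrow> c \<in> D \<Longrightarrow> slide lam T c \<in> tabloids lam"
  by (simp add: slide_def slide_aux_tabloid)

lemma path_end_in_D:
  assumes "slide_path D T a i0 j0 p s" "(i0, j0) \<in> D"
  shows "(p, s (Suc p)) \<in> D"
proof -
  note P = slide_pathD[OF assms(1)]
  consider "s p < s (Suc p)" | "s p = s (Suc p)" "i0 < p" | "s p = s (Suc p)" "i0 = p"
    using P(1) P(3)[of p] by linarith
  then show ?thesis
  proof cases
    case 1
    then show ?thesis using P(1) P(4)[of p "s (Suc p) - 1"] by simp
  next
    case 2
    then show ?thesis using P(7)[of "p - 1"] by simp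
  qed (use P assms in auto)
qed

lemma path_in_D:
  assumes "(p, s (Suc p)) \<in> D" "1 \<le> i0" "1 \<le> s i0"
    "\<And>i. i0 \<le> i \<Longrightarrow> i \<le> p \<Longrightarrow> s i \<le> s (Suc i)" "on_path i0 p s (i, j)"
  shows "(i, j) \<in> D" "s i0 \<le> j" "i = i0 \<and> j = s i0 \<or> (i, j) \<in> after i0 (s i0)"
proof -
  have h: "i0 \<le> i" "i \<le> p" "s i \<le> j" "j \<le> s (Suc i)"
    using assms(5) by (auto simp: on_path_def)
  have "s i0 \<le> s i" "s (Suc i) \<le> s (Suc p)"
    using path_mono[of i0 p s i0 i] path_mono[of i0 p s "Suc i" "Suc p"] assms(4) h by auto
  then show 1: "(i, j) \<in> D" "s i0 \<le> j" using D_mono[OF assms(1), of i j] assms h by auto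
  show "i = i0 \<and> j = s i0 \<or> (i, j) \<in> after i0 (s i0)"
    using 1 h by (auto simp: after_def)
qed

lemma slide_eq_shift_path:
  assumes "slide_path D T (T (i0, j0)) i0 j0 p s" "(i0, j0) \<in> D"
  shows "slide lam T (i0, j0) = shift_path i0 p s T"
  unfolding slide_def
proof (rule slide_aux_eq_shift_path[OF assms(1)])
  note P = slide_pathD[OF assms(1)]
  have e: "(p, s (Suc p)) \<in> D" using path_end_in_D assms by blast
  have "s i0 \<le> s (Suc p)" using path_mono[of i0 p s i0 "Suc p"] P(1,3) by simp
  then have j: "j0 \<le> s (Suc p)" using P(2) by simp
  \<comment> \<open>Straight down to row \<open>p\<close>, then straight to the end: this hook lies
    in \<open>D\<close> since its corner is dominated by the end of the path, and it has one cell
    more than the path has exchanges. Hence the fuel \<open>card D\<close> suffices.\<close>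
  let ?A = "{i0..p} \<times> {j0}" and ?B = "{p} \<times> {j0<..s (Suc p)}"
  have "?A \<union> ?B \<subseteq> D"
    using D_mono[OF e] j P(1) assms(2) by (auto simp: mem_D)
  moreover have "card (?A \<union> ?B) = (p - i0) + (s (Suc p) - j0) + 1"
    using P(1) j by (subst card_Un_disjoint) (auto simp: card_cartesian_product)
  ultimately show "p - i0 + (s (Suc p) - j0) \<le> card D"
    using card_mono[OF finite_D, of "?A \<union> ?B"] by simp
qed

end

section \<open>Reverse paths\<close>

text \<open>The reverse path moves each time to the larger of the upper and left neighbours, without
  leaving the columns from j0 on. Entering row i in column y, it passes from row i to row i - 1 in
  the column given below; j0 is also the default value when no column qualifies.\<close>
definition cross_col :: "filling \<Rightarrow> nat \<Rightarrow> nat \<Rightarrow> nat \<Rightarrow> nat" where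
  "cross_col T j0 i y = Max {j \<in> {j0..y}. j = j0 \<or> T (i, j - 1) < T (i - 1, j)}"

text \<open>Indexed like \<open>s\<close> in \<open>slide_path\<close>: the reverse path from
  \<open>(p, q)\<close> occupies the columns from \<open>rev_col T j0 q p i\<close> to
  \<open>rev_col T j0 q p (Suc i)\<close> of row \<open>i\<close>, whence the value \<open>q\<close>
  at \<open>Suc p\<close>.\<close>

definition rev_col :: "filling \<Rightarrow> nat \<Rightarrow> nat \<Rightarrow> nat \<Rightarrow> nat \<Rightarrow> nat" where
  "rev_col T j0 q p i = fold (cross_col T j0) (rev [i..<Suc p]) q"

lemma rev_col_start: "rev_col T j0 q p (Suc p) = q"
  by (simp add: rev_col_def)

lemma rev_col_rec: "i \<le> p \<Longrightarrow> rev_col T j0 q p i = cross_col T j0 i (rev_col T j0 q p (Suc i))"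
  using upt_conv_Cons[of i "Suc p"] by (simp add: rev_col_def del: upt_Suc)

lemma cross_col_bounds:
  assumes "j0 \<le> y"
  shows "j0 \<le> cross_col T j0 i y" "cross_col T j0 i y \<le> y"
    "j0 < cross_col T j0 i y \<Longrightarrow> T (i, cross_col T j0 i y - 1) < T (i - 1, cross_col T j0 i y)"
proof -
  let ?S = "{j \<in> {j0..y}. j = j0 \<or> T (i, j - 1) < T (i - 1, j)}"
  have "Max ?S \<in> ?S" using assms by (intro Max_in) auto
  then show "j0 \<le> cross_col T j0 i y" "cross_col T j0 i y \<le> y"
    "j0 < cross_col T j0 i y \<Longrightarrow> T (i, cross_col T j0 i y - 1) < T (i - 1, cross_col T j0 i y)"
    unfolding cross_col_def by auto
qed

lemma not_cross:
  assumes "cross_col T j0 i y < j" "j0 \<le> j" "j \<le> y"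
  shows "\<not> T (i, j - 1) < T (i - 1, j)"
proof
  assume "T (i, j - 1) < T (i - 1, j)"
  then have "j \<le> cross_col T j0 i y" unfolding cross_col_def using assms by (intro Max_ge) auto
  then show False using assms by simp
qed

lemma cross_col_le:
  assumes "j0 \<le> y" "j0 \<le> g" "\<And>j. g < j \<Longrightarrow> j \<le> y \<Longrightarrow> \<not> T (i, j - 1) < T (i - 1, j)"
  shows "cross_col T j0 i y \<le> g"
  using cross_col_bounds[OF assms(1), of T i] assms(2,3) by (meson le_less_trans not_le)

lemma cross_col_mono:
  assumes "j0 \<le> y" "y \<le> y'"
  shows "cross_col T j0 i y \<le> cross_col T j0 i y'"
  using assms cross_col_bounds(1)[of j0 y' T i] not_cross[of T j0 i y']
  by (intro cross_col_le) auto

lemma cross_col_eqI: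
  assumes "j0 \<le> g" "g \<le> y" "j0 < g \<Longrightarrow> T (i, g - 1) < T (i - 1, g)"
    "\<And>j. g < j \<Longrightarrow> j \<le> y \<Longrightarrow> \<not> T (i, j - 1) < T (i - 1, j)"
  shows "cross_col T j0 i y = g"
proof (rule antisym)
  show "cross_col T j0 i y \<le> g" using assms by (intro cross_col_le) auto
  show "g \<le> cross_col T j0 i y" unfolding cross_col_def using assms by (intro Max_ge) (auto simp: le_less)
qed

lemma cross_col_cong:
  assumes "\<And>j. j0 < j \<Longrightarrow> T (i, j - 1) = T' (i, j - 1)" "\<And>j. j0 < j \<Longrightarrow> T (i - 1, j) = T' (i - 1, j)"
  shows "cross_col T j0 i y = cross_col T' j0 i y"
proof -
  have "{j \<in> {j0..y}. j = j0 \<or> T (i, j - 1) < T (i - 1, j)}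
      = {j \<in> {j0..y}. j = j0 \<or> T' (i, j - 1) < T' (i - 1, j)}"
    using assms by (auto simp: le_less)
  then show ?thesis by (simp add: cross_col_def)
qed

lemma rev_col_bounds:
  assumes "j0 \<le> q" "i \<le> Suc p"
  shows "j0 \<le> rev_col T j0 q p i \<and> (\<forall>i'. i \<le> i' \<and> i' \<le> Suc p \<longrightarrow> rev_col T j0 q p i \<le> rev_col T j0 q p i')"
  using assms(2)
proof (induction i rule: inc_induct)
  case base
  then show ?case using assms by (auto simp: rev_col_start)
next
  case (step i)
  then have r: "rev_col T j0 q p i = cross_col T j0 i (rev_col T j0 q p (Suc i))"
    by (simp add: rev_col_rec)
  have le: "j0 \<le> rev_col T j0 q p i" "rev_col T j0 q p i \<le> rev_col T j0 q p (Suc i)"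
    using cross_col_bounds(1,2)[of j0 "rev_col T j0 q p (Suc i)" T i] step.IH by (simp_all add: r)
  have "rev_col T j0 q p i \<le> rev_col T j0 q p i'" if "i \<le> i'" "i' \<le> Suc p" for i'
    using that le(2) step.IH by (cases "i' = i") (auto intro: le_trans simp: Suc_le_eq)
  then show ?case using le(1) by blast
qed

text \<open>Reverse paths do not cross: \<open>cross_col\<close> is monotone in the entry column, so
  a path that is weakly to the left in row \<open>k\<close> stays so in all rows above.\<close>

lemma rev_col_mono:
  assumes "j0 \<le> q" "j0 \<le> q'" "i \<le> k" "k \<le> Suc p" "k \<le> Suc p'"
    "rev_col T j0 q p k \<le> rev_col T j0 q' p' k"
  shows "rev_col T j0 q p i \<le> rev_col T j0 q' p' i"
  using assms(3)
proof (induction i rule: inc_induct)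
  case (step i)
  then show ?case
    using rev_col_rec[of i p T j0 q] rev_col_rec[of i p' T j0 q'] assms(4,5)
      cross_col_mono[of j0 "rev_col T j0 q p (Suc i)" "rev_col T j0 q' p' (Suc i)" T i]
      rev_col_bounds[OF assms(1), of "Suc i" p T] by simp
qed (use assms in simp)

lemma rev_col_cong:
  assumes "\<And>i j. m \<le> i \<Longrightarrow> T (i, j) = T' (i, j)" "Suc m \<le> i" "i \<le> Suc p"
  shows "rev_col T j0 q p i = rev_col T' j0 q p i"
  using assms(3,2)
proof (induction i rule: inc_induct)
  case (step i)
  then show ?case using assms(1)
    by (auto simp: rev_col_rec intro!: cross_col_cong)
qed (simp add: rev_col_start)

section \<open>Hook functions\<close>

text \<open>The update of the hook function by a slide from (i0, j0) that ends in row p and column e.\<close>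
definition bump :: "nat \<Rightarrow> nat \<Rightarrow> nat \<Rightarrow> nat \<Rightarrow> (cell \<Rightarrow> int) \<Rightarrow> cell \<Rightarrow> int" where
  "bump i0 j0 p e J = (\<lambda>(i, j). if j = j0 \<and> i0 \<le> i \<and> i < p then J (Suc i, j0) - 1
     else if i = p \<and> j = j0 then int e - int j0 else J (i, j))"

text \<open>Undoing the slide removes the starting cell from the domain of the hook function, and
  \<open>PiE\<close> demands \<open>undefined\<close> outside the domain.\<close>

definition unbump :: "nat \<Rightarrow> nat \<Rightarrow> nat \<Rightarrow> (cell \<Rightarrow> int) \<Rightarrow> cell \<Rightarrow> int" where
  "unbump i0 j0 p J = (\<lambda>(i, j). if j = j0 \<and> i0 < i \<and> i \<le> p then J (i - 1, j0) + 1
     else if i = i0 \<and> j = j0 then undefined else J (i, j))"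

lemma bump_unbump: "i0 \<le> p \<Longrightarrow> J (p, j0) = int e - int j0 \<Longrightarrow> bump i0 j0 p e (unbump i0 j0 p J) = J"
  by (auto simp: bump_def unbump_def fun_eq_iff)

lemma unbump_bump: "i0 \<le> p \<Longrightarrow> J (i0, j0) = undefined \<Longrightarrow> unbump i0 j0 p (bump i0 j0 p e J) = J"
  by (auto simp: bump_def unbump_def fun_eq_iff)

lemma unshift_shift_path:
  assumes "i0 \<le> p" "\<And>i. i0 \<le> i \<Longrightarrow> i \<le> p \<Longrightarrow> s i \<le> s (Suc i)"
  shows "unshift_path i0 p s (shift_path i0 p s T) = T"
proof
  fix c :: cell
  obtain i j where c: "c = (i, j)" by fastforce
  have "s (i - 1) \<le> s i" "on_path i0 p s (i - 1, s i)" if "i0 < i" "i \<le> p"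
    using that assms(2)[of "i - 1"] by (auto simp: on_path_def)
  moreover have "on_path i0 p s (p, s (Suc p))" using assms by (auto simp: on_path_def)
  ultimately show "unshift_path i0 p s (shift_path i0 p s T) c = T c"
    unfolding c by (auto simp: shift_path_def unshift_path_def on_path_def split: if_splits)
qed

lemma shift_unshift_path:
  assumes "i0 \<le> p" "\<And>i. i0 \<le> i \<Longrightarrow> i \<le> p \<Longrightarrow> s i \<le> s (Suc i)"
  shows "shift_path i0 p s (unshift_path i0 p s T) = T"
proof
  fix c :: cell
  obtain i j where c: "c = (i, j)" by fastforce
  have "s (Suc i) \<le> s (Suc (Suc i))" if "i0 \<le> i" "i < p"
    using that assms(2)[of "Suc i"] by auto
  moreover have "s i0 \<le> s (Suc i0)" using assms by auto
  ultimately show "shift_path i0 p s (unshift_path i0 p s T) c = T c"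
    unfolding c by (auto simp: shift_path_def unshift_path_def on_path_def split: if_splits)
qed

lemma path_cong:
  assumes "i0 \<le> p" "\<And>i. i0 \<le> i \<Longrightarrow> i \<le> Suc p \<Longrightarrow> s i = s' i"
  shows "unshift_path i0 p s T = unshift_path i0 p s' T" "shift_path i0 p s T = shift_path i0 p s' T"
  using assms by (auto simp: fun_eq_iff unshift_path_def shift_path_def on_path_def)

text \<open>Every nonnegative value of the hook function in column j0 marks a cell (p, q) in which
  the last slide may have ended. The cell of the actual last slide is the one whose reverse
  path runs above those of all others, which makes the step invertible.\<close>
definition (in partition) cand :: "(cell \<Rightarrow> int) \<Rightarrow> nat \<Rightarrow> nat \<Rightarrow> nat \<Rightarrow> bool" where
  "cand J j0 p q \<longleftrightarrow> (p, j0) \<in> D \<and> 0 \<le> J (p, j0) \<and> q = j0 + nat (J (p, j0))"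

text \<open>Two reverse paths are compared only where the one that starts higher begins;
  \<open>rev_col_mono\<close> carries the comparison to the rows above. Ties are decided in favour
  of the higher start, so one condition is strict and the other weak.\<close>

definition (in partition) topmost ::
  "filling \<Rightarrow> (cell \<Rightarrow> int) \<Rightarrow> nat \<Rightarrow> nat \<Rightarrow> nat \<Rightarrow> nat \<Rightarrow> bool" where
  "topmost T J i0 j0 p q \<longleftrightarrow> i0 \<le> p \<and> cand J j0 p q \<and>
     (\<forall>p2 q2. i0 \<le> p2 \<and> p2 < p \<and> cand J j0 p2 q2 \<longrightarrow> q2 < rev_col T j0 q p (Suc p2)) \<and>
     (\<forall>p2 q2. p < p2 \<and> cand J j0 p2 q2 \<longrightarrow> rev_col T j0 q2 p2 (Suc p) \<le> q)"

text \<open>The last condition says that no reverse path from a candidate would cross into row m.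
  This is what characterises the image of the forward steps within a column; it is vacuous
  between two columns.\<close>
definition (in partition) state :: "nat \<Rightarrow> nat \<Rightarrow> (filling \<times> (cell \<Rightarrow> int)) set" where
  "state m j0 = {(T, J). T \<in> tabloids lam \<and> increasing_on (after m j0) T \<and>
     J \<in> (\<Pi>\<^sub>E c\<in>after m j0. {- leg c..arm c}) \<and>
     (\<forall>p q. m < p \<and> cand J j0 p q \<longrightarrow> rev_col T j0 q p (Suc m) = j0)}"

context partition
begin

lemma cand_ge: "cand J j0 p q \<Longrightarrow> j0 \<le> q"
  by (auto simp: cand_def)

lemma cand_unique: "cand J j0 p q \<Longrightarrow> cand J j0 p q' \<Longrightarrow> q = q'"
  by (auto simp: cand_def)

lemma cand_in_D:
  assumes "cand J j0 p q" "J \<in> (\<Pi>\<^sub>E c\<in>after m j0. {- leg c..arm c})" "m < p"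
  shows "(p, q) \<in> D"
proof -
  have "(p, j0) \<in> after m j0" using assms by (auto simp: cand_def after_def)
  then have "J (p, j0) \<le> arm (p, j0)" using assms(2) by (auto dest: PiE_mem)
  then show ?thesis using assms(1) by (auto simp: cand_def arm_def mem_D)
qed

text \<open>For two such cells in different rows, the strict condition for the lower one contradicts
  the weak condition for the upper one.\<close>

lemma topmost_unique:
  assumes "topmost T J i0 j0 p q" "topmost T J i0 j0 p' q'"
  shows "p = p' \<and> q = q'"
proof -
  have False if "topmost T J i0 j0 p q" "topmost T J i0 j0 p' q'" "p < p'" for p p' q q'
    using that unfolding topmost_def by (meson leD)
  then have "p = p'" using assms by (meson linorder_neqE_nat)
  then show ?thesis using assms cand_unique unfolding topmost_def by blast
qed

text \<open>The rows are added from the top, each with at most one candidate. A new candidate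
  replaces the current one when its reverse path passes strictly to the right of it, and by
  \<open>rev_col_mono\<close> it then beats all earlier candidates as well.\<close>

lemma topmost_exists:
  assumes "i0 \<le> p0" "cand J j0 p0 q0"
  shows "\<exists>p q. topmost T J i0 j0 p q"
proof -
  \<comment> \<open>\<open>top M\<close> is \<open>topmost\<close> among the candidates in rows up
    to \<open>M\<close>.\<close>
  define top where "top = (\<lambda>M p q. i0 \<le> p \<and> cand J j0 p q \<and>
     (\<forall>p2 q2. i0 \<le> p2 \<and> p2 < p \<and> cand J j0 p2 q2 \<longrightarrow> q2 < rev_col T j0 q p (Suc p2)) \<and>
     (\<forall>p2 q2. p < p2 \<and> p2 \<le> M \<and> cand J j0 p2 q2 \<longrightarrow> rev_col T j0 q2 p2 (Suc p) \<le> q))"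
  have "(\<exists>p q. i0 \<le> p \<and> p \<le> M \<and> cand J j0 p q) \<longrightarrow> (\<exists>p q. p \<le> M \<and> top M p q)" for M
  proof (induction M)
    case 0
    then show ?case by (auto simp: top_def)
  next
    case (Suc M)
    show ?case
    proof
      assume ex: "\<exists>p q. i0 \<le> p \<and> p \<le> Suc M \<and> cand J j0 p q"
      show "\<exists>p q. p \<le> Suc M \<and> top (Suc M) p q"
      proof (cases "\<exists>p q. i0 \<le> p \<and> p \<le> M \<and> cand J j0 p q")
        case False
        then obtain q where q: "cand J j0 (Suc M) q" "i0 \<le> Suc M"
          using ex by (metis le_SucE)
        have "top (Suc M) (Suc M) q"
          using q False by (auto simp: top_def)
        then show ?thesis by blast
      next
        case True
        then obtain p q where t: "p \<le> M" "top M p q" using Suc.IH by blast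
        note t' = t(2)[unfolded top_def]
        have pq: "i0 \<le> p" "cand J j0 p q" using t' by blast+
        show ?thesis
        proof (cases "\<exists>q3. cand J j0 (Suc M) q3 \<and> q < rev_col T j0 q3 (Suc M) (Suc p)")
          case False
          then have "top (Suc M) p q"
            using t t' unfolding top_def by (auto simp: le_Suc_eq not_less)
          then show ?thesis using t(1) le_SucI by blast
        next
          case True
          then obtain q3 where q3: "cand J j0 (Suc M) q3" "q < rev_col T j0 q3 (Suc M) (Suc p)" by blast
          have "q2 < rev_col T j0 q3 (Suc M) (Suc p2)" if h: "i0 \<le> p2" "p2 \<le> M" "cand J j0 p2 q2" for p2 q2
          proof (cases p2 p rule: linorder_cases)
            case less
            have "q2 < rev_col T j0 q p (Suc p2)" using t' h less by blast
            also have "\<dots> \<le> rev_col T j0 q3 (Suc M) (Suc p2)"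
              using q3(2) t(1) less cand_ge[OF q3(1)] cand_ge[OF pq(2)]
              by - (rule rev_col_mono[where k = "Suc p"]; simp add: rev_col_start less_imp_le)
            finally show ?thesis .
          next
            case equal
            then show ?thesis using q3(2) cand_unique[OF pq(2)] h(3) by blast
          next
            case greater
            show ?thesis
            proof (rule ccontr)
              assume "\<not> ?thesis"
              then have "rev_col T j0 q3 (Suc M) (Suc p2) \<le> rev_col T j0 q2 p2 (Suc p2)"
                by (simp add: rev_col_start)
              then have "rev_col T j0 q3 (Suc M) (Suc p) \<le> rev_col T j0 q2 p2 (Suc p)"
                using h(2) greater cand_ge[OF q3(1)] cand_ge[OF h(3)]
                by - (rule rev_col_mono[where k = "Suc p2"]; simp)
              also have "\<dots> \<le> q" using t' h greater by blast
              finally show False using q3 by simp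
            qed
          qed
          then have "top (Suc M) (Suc M) q3"
            using q3(1) pq(1) t(1) by (simp add: top_def less_Suc_eq_le)
          then show ?thesis by blast
        qed
      qed
    qed
  qed
  \<comment> \<open>All candidates lie in rows up to \<open>conj_part lam j0\<close>; adding
    \<open>p0\<close> makes \<open>p0 \<le> M\<close> immediate.\<close>
  moreover define M where "M = conj_part lam j0 + p0"
  have "p2 \<le> M" if "cand J j0 p2 q2" for p2 q2
    using that mem_D_column[of j0 p2] by (auto simp: cand_def M_def mem_D)
  moreover have "i0 \<le> p0 \<and> p0 \<le> M" using assms by (simp add: M_def)
  ultimately have "\<exists>p q. top M p q" using assms by blast
  then show ?thesis
    using \<open>\<And>p2 q2. cand J j0 p2 q2 \<Longrightarrow> p2 \<le> M\<close> unfolding top_def topmost_def by metis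
qed

lemma after_Suc: "(Suc m, j0) \<in> D \<Longrightarrow> after m j0 = insert (Suc m, j0) (after (Suc m) j0)"
  by (auto simp: after_def)

lemma not_in_after [simp]: "(m, j0) \<notin> after m j0"
  by (simp add: after_def)

end

section \<open>One sorting step is a bijection\<close>

locale forward_step = partition +
  fixes T :: filling and J :: "cell \<Rightarrow> int" and m j0 p :: nat and s :: "nat \<Rightarrow> nat"
  assumes TJ: "(T, J) \<in> state (Suc m) j0"
    and z_in_D: "(Suc m, j0) \<in> D"
    and path: "slide_path D T (T (Suc m, j0)) (Suc m) j0 p s"
begin

abbreviation "i0 \<equiv> Suc m"
abbreviation "W \<equiv> after i0 j0"
abbreviation "T' \<equiv> shift_path i0 p s T"
abbreviation "J' \<equiv> bump i0 j0 p (s (Suc p)) J"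

lemmas P = slide_pathD[OF path]

lemma T: "T \<in> tabloids lam" "increasing_on W T"
  and J: "J \<in> (\<Pi>\<^sub>E c\<in>W. {- leg c..arm c})"
  and inv: "\<And>p q. i0 < p \<Longrightarrow> cand J j0 p q \<Longrightarrow> rev_col T j0 q p (Suc i0) = j0"
  using TJ by (auto simp: state_def)

lemma j0: "1 \<le> j0" using z_in_D by (simp add: mem_D)

lemma s_mono: "i0 \<le> i \<Longrightarrow> i \<le> i' \<Longrightarrow> i' \<le> Suc p \<Longrightarrow> s i \<le> s i'"
  using path_mono[of i0 p s] P(3) by blast

lemma s_ge: "i0 \<le> i \<Longrightarrow> i \<le> Suc p \<Longrightarrow> j0 \<le> s i"
  using s_mono[of i0 i] P(2) by simp

lemma end_in_D: "(p, s (Suc p)) \<in> D"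
  using path_end_in_D[OF path z_in_D] .

lemma on_pathD:
  assumes "on_path i0 p s (i, j)"
  shows "(i, j) \<in> D" "j0 \<le> j" "(i, j) = (i0, j0) \<or> (i, j) \<in> W"
  using path_in_D[OF end_in_D _ _ _ assms] P(2,3) j0 by auto

lemma W_eq: "after m j0 = insert (i0, j0) W"
  using after_Suc z_in_D by simp

lemma T'_right: "i0 \<le> i \<Longrightarrow> i \<le> p \<Longrightarrow> s i \<le> j \<Longrightarrow> j < s (Suc i) \<Longrightarrow> T' (i, j) = T (i, Suc j)"
  by (simp add: shift_path_def on_path_def)

lemma T'_down: "i0 \<le> i \<Longrightarrow> i < p \<Longrightarrow> T' (i, s (Suc i)) = T (Suc i, s (Suc i))"
  using P(3)[of i] by (simp add: shift_path_def on_path_def)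

lemma T'_end: "T' (p, s (Suc p)) = T (i0, j0)"
  using P(1,2) P(3)[of p] by (simp add: shift_path_def on_path_def)

lemma T'_off: "\<not> on_path i0 p s c \<Longrightarrow> T' c = T c"
  by (cases c) (simp add: shift_path_def)

lemma on_path_cases [consumes 1]:
  assumes "on_path i0 p s (i, j)"
  obtains (right) "i0 \<le> i" "i \<le> p" "s i \<le> j" "j < s (Suc i)"
    | (down) "i0 \<le> i" "i < p" "j = s (Suc i)" "s i \<le> j"
    | (stop) "i = p" "j = s (Suc p)" "i0 \<le> p" "s i \<le> j"
  using assms by (fastforce simp: on_path_def)

lemma on_path_less:
  assumes "on_path i0 p s (i, j)" "(i, j) \<noteq> (i0, j0)"
  shows "T (i, j) < T (i0, j0)"
proof -
  have h: "i0 \<le> i" "i \<le> p" "s i \<le> j" "j \<le> s (Suc i)" using assms by (auto simp: on_path_def)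
  show ?thesis
  proof (cases "s i < j")
    case True
    then show ?thesis using P(5)[of i "j - 1"] h by simp
  next
    case False
    then have "j = s i" "i0 < i" using h assms(2) P(2) by (auto simp: le_less)
    then show ?thesis using P(8)[of "i - 1"] h by simp
  qed
qed

text \<open>A cell of the path receives either the entry to its right or below it, which is larger
  because both cells lie in the sorted region \<open>W\<close>, or the moving entry, which exceeds
  all others on the path. The starting cell does not belong to \<open>W\<close>.\<close>

lemma T'_greater:
  assumes "on_path i0 p s (i, j)" "(i, j) \<noteq> (i0, j0)"
  shows "T (i, j) < T' (i, j)"
  using assms(1)
proof (cases rule: on_path_cases)
  case right
  then have "on_path i0 p s (i, Suc j)" by (simp add: on_path_def)
  then have "(i, Suc j) \<in> W" using on_pathD(3)[of i "Suc j"] right s_ge[of i] by auto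
  moreover have "(i, j) \<in> W" using on_pathD(3) assms by blast
  ultimately show ?thesis using increasing_onD(1)[OF T(2)] T'_right right by simp
next
  case down
  then have "on_path i0 p s (Suc i, j)" using P(3)[of "Suc i"] by (simp add: on_path_def)
  then have "(Suc i, j) \<in> W" using on_pathD(3)[of "Suc i" j] down by auto
  moreover have "(i, j) \<in> W" using on_pathD(3) assms by blast
  ultimately show ?thesis using increasing_onD(2)[OF T(2)] T'_down down by simp
next
  case stop
  then show ?thesis using on_path_less[OF assms] T'_end by simp
qed

text \<open>If the first cell of a pair is on the path, the choices made by the slide give the
  inequality; if it is not, its entry is unchanged while that of the second cell can only have
  grown.\<close>

lemma T'_increasing: "increasing_on (after m j0) T'"
  unfolding increasing_on_def
proof (intro conjI allI impI; elim conjE)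
  fix i j assume h: "(i, j) \<in> after m j0" "(i, Suc j) \<in> after m j0"
  have d: "(i, Suc j) \<noteq> (i0, j0)" using h by (auto simp: after_def)
  have inW: "(i, j) \<in> W" if "(i, j) \<noteq> (i0, j0)" using h that W_eq by auto
  have dW: "(i, Suc j) \<in> W" using h d W_eq by auto
  have dD: "(i, Suc j) \<in> D" using h by (simp add: after_def)
  show "T' (i, j) < T' (i, Suc j)"
  proof (cases "on_path i0 p s (i, j)")
    case True
    then show ?thesis
    proof (cases rule: on_path_cases)
      case right
      then have "on_path i0 p s (i, Suc j)" by (simp add: on_path_def)
      then show ?thesis using T'_greater d T'_right right by simp
    next
      case down
      then have "\<not> on_path i0 p s (i, Suc j)" by (simp add: on_path_def)
      then show ?thesis using T'_off T'_down P(9)[of i] down dD by simp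
    next
      case stop
      then have "\<not> on_path i0 p s (i, Suc j)" by (simp add: on_path_def)
      then show ?thesis
        using T'_off T'_end stop dD P(10) d inj_onD[OF tabloid_inj[OF T(1)], of "(i, Suc j)" "(i0, j0)"] z_in_D
        by (metis linorder_neqE_nat)
    qed
  next
    case off: False
    have "T (i, j) < T (i, Suc j)"
    proof (cases "(i, j) = (i0, j0)")
      case True
      then show ?thesis using off P(1,2) P(3)[of i0] by (simp add: on_path_def)
    qed (use inW increasing_onD(1)[OF T(2)] dW in blast)
    also have "\<dots> \<le> T' (i, Suc j)"
      using T'_greater[of i "Suc j"] d T'_off[of "(i, Suc j)"] by fastforce
    finally show ?thesis using T'_off[OF off] by simp
  qed
next
  fix i j assume h: "(i, j) \<in> after m j0" "(Suc i, j) \<in> after m j0"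
  have d: "(Suc i, j) \<noteq> (i0, j0)" using h by (auto simp: after_def)
  have inW: "(i, j) \<in> W" if "(i, j) \<noteq> (i0, j0)" using h that W_eq by auto
  have dW: "(Suc i, j) \<in> W" using h d W_eq by auto
  have dD: "(Suc i, j) \<in> D" using h by (simp add: after_def)
  show "T' (i, j) < T' (Suc i, j)"
  proof (cases "on_path i0 p s (i, j)")
    case True
    then show ?thesis
    proof (cases rule: on_path_cases)
      case right
      then have "\<not> on_path i0 p s (Suc i, j)" by (simp add: on_path_def)
      then show ?thesis using T'_off T'_right P(6)[of i j] right dD by simp
    next
      case down
      then have "on_path i0 p s (Suc i, j)" using P(3)[of "Suc i"] by (simp add: on_path_def)
      then show ?thesis using T'_greater[of "Suc i" j] d T'_down down by simp
    next
      case stop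
      then have "\<not> on_path i0 p s (Suc i, j)" by (simp add: on_path_def)
      then show ?thesis
        using T'_off T'_end stop dD P(11) d inj_onD[OF tabloid_inj[OF T(1)], of "(Suc i, j)" "(i0, j0)"] z_in_D
        by (metis linorder_neqE_nat)
    qed
  next
    case off: False
    have "T (i, j) < T (Suc i, j)"
    proof (cases "(i, j) = (i0, j0)")
      case True
      then show ?thesis using off P(1,2) P(3)[of i0] by (simp add: on_path_def)
    qed (use inW increasing_onD(2)[OF T(2)] dW in blast)
    also have "\<dots> \<le> T' (Suc i, j)"
      using T'_greater[of "Suc i" j] d T'_off[of "(Suc i, j)"] by fastforce
    finally show ?thesis using T'_off[OF off] by simp
  qed
qed

lemma T'_tabloid: "T' \<in> tabloids lam"
  using slide_eq_shift_path[OF path z_in_D] slide_tabloid[OF T(1) z_in_D] by simp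

text \<open>The reverse path retraces the slide. In column \<open>s i\<close> the cell above now
  holds the old entry of \<open>(i, s i)\<close>, which exceeds its left neighbour. For columns
  \<open>j\<close> further right the left neighbour holds the old \<open>T (i, j)\<close>, which is
  not smaller than the entry above.\<close>

lemma cross_col_T':
  assumes "i0 \<le> i" "i \<le> p"
  shows "cross_col T' j0 i (s (Suc i)) = s i"
proof (rule cross_col_eqI)
  show "j0 \<le> s i" "s i \<le> s (Suc i)" using s_ge assms P(3) by auto
next
  assume gt: "j0 < s i"
  then have "i0 < i" using P(2) assms by (cases "i = i0") auto
  then obtain i1 where i1: "i = Suc i1" "i0 \<le> i1" by (cases i) auto
  have "\<not> on_path i0 p s (i, s i - 1)" using gt by (auto simp: on_path_def)
  moreover have "(i, s i) \<in> D" "(i, s i - 1) \<in> D"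
    using P(7)[of i1] i1 assms gt j0 by (auto simp: mem_D)
  then have "T (i, s i - 1) < T (i, s i)"
    using increasing_onD(1)[OF T(2), of i "s i - 1"] gt \<open>i0 < i\<close> le_less[of j0 "s i - 1"]
    by (auto simp: after_def)
  ultimately show "T' (i, s i - 1) < T' (i - 1, s i)"
    using T'_off T'_down[of i1] i1 assms by simp
next
  fix j assume j: "s i < j" "j \<le> s (Suc i)"
  have "T' (i, j - 1) = T (i, j)" using T'_right[of i "j - 1"] j assms by simp
  moreover have "T' (i - 1, j) = T (i - 1, j)"
    using j assms P(3) by (intro T'_off) (auto simp: on_path_def)
  moreover have "T (i - 1, j) \<le> T (i, j)"
  proof (cases "i = i0")
    case True
    have on: "(i, j) \<in> D" using on_pathD(1)[of i j] j assms by (simp add: on_path_def)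
    show ?thesis
    \<comment> \<open>In row 0, outside the diagram, every tabloid has the value 0.\<close>
    proof (cases "m = 0")
      case True
      then have "T (i - 1, j) = 0" using T(1) \<open>i = i0\<close> by (auto simp: tabloids_iff mem_D)
      then show ?thesis by simp
    next
      case False
      then have "(m, j) \<in> D" using D_mono[OF on, of m j] \<open>i = i0\<close> j0 j s_ge[of i] assms by simp
      moreover have "j0 < j" using j s_ge[of i] assms by simp
      ultimately show ?thesis using increasing_onD(2)[OF T(2), of m j] on \<open>i = i0\<close>
        by (auto simp: after_def)
    qed
  next
    case False
    then obtain i1 where i1: "i = Suc i1" "i0 \<le> i1" using assms(1) by (cases i) auto
    have "on_path i0 p s (i, j)" using j assms by (simp add: on_path_def)
    then have "(i, j) \<in> D" "j0 < j" using on_pathD(1) j s_ge[of i] assms by auto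
    then show ?thesis
      using increasing_onD(2)[OF T(2), of i1 j] i1 D_mono[of i j i1 j] j0 by (auto simp: after_def)
  qed
  ultimately show "\<not> T' (i, j - 1) < T' (i - 1, j)" by simp
qed

lemma rev_col_T': "i0 \<le> i \<Longrightarrow> i \<le> Suc p \<Longrightarrow> rev_col T' j0 (s (Suc p)) p i = s i"
proof (induction "Suc p - i" arbitrary: i)
  case 0
  then have "i = Suc p" by simp
  then show ?case by (simp add: rev_col_start)
next
  case (Suc d)
  then have "rev_col T' j0 (s (Suc p)) p (Suc i) = s (Suc i)" by simp
  then show ?case using Suc.prems Suc.hyps(2) by (simp add: rev_col_rec cross_col_T')
qed

text \<open>The slide path cannot cross the reverse path of an old candidate from above.\<close>
lemma above_candidate:
  assumes "cand J j0 p2 q2" "i0 \<le> i" "i \<le> p" "i \<le> p2" "i0 < p2"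
  shows "rev_col T j0 q2 p2 (Suc i) \<le> s i"
  using assms(2,3,4)
proof (induction i rule: dec_induct)
  case base
  then show ?case using inv[OF assms(5,1)] P(2) by simp
next
  case (step i)
  let ?x = "rev_col T j0 q2 p2"
  show ?case
  proof (rule ccontr)
    assume "\<not> ?thesis"
    \<comment> \<open>Now the reverse path passes column \<open>Suc (s (Suc i))\<close> of row
      \<open>Suc i\<close> without crossing, so \<open>T (Suc i, s (Suc i))\<close> is not smaller
      than \<open>T (i, Suc (s (Suc i)))\<close>. But the slide went down in column
      \<open>s (Suc i)\<close> because of the opposite inequality.\<close>
    then have gt: "s (Suc i) < ?x (Suc (Suc i))" by simp
    have r: "?x (Suc i) = cross_col T j0 (Suc i) (?x (Suc (Suc i)))"
      using step by (simp add: rev_col_rec)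
    have "?x (Suc i) \<le> s (Suc i)" using step P(3)[of i] by (auto intro: le_trans)
    then have "\<not> T (Suc i, s (Suc i)) < T (i, Suc (s (Suc i)))"
      using not_cross[of T j0 "Suc i" "?x (Suc (Suc i))" "Suc (s (Suc i))"] r gt s_ge[of "Suc i"] step
      by simp
    moreover have "(i, Suc (s (Suc i))) \<in> D"
    proof -
      have "?x (Suc (Suc i)) \<le> q2"
        using rev_col_bounds[of j0 q2 "Suc (Suc i)" p2 T] cand_ge[OF assms(1)] step.prems
        by (auto simp: rev_col_start)
      then have "Suc (s (Suc i)) \<le> q2" using gt by simp
      moreover have "(p2, q2) \<in> D" using cand_in_D assms(1,5) J by blast
      ultimately show ?thesis using D_mono[of p2 q2 i "Suc (s (Suc i))"] step by simp
    qed
    then have "T (Suc i, s (Suc i)) < T (i, Suc (s (Suc i)))"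
      using P(9)[of i] step by simp
    ultimately show False by simp
  qed
qed

text \<open>The update moves the old candidates beside the path one cell up and one cell left, puts
  the end of the slide into row \<open>p\<close>, and leaves the candidates below alone.\<close>

lemma cand_bumpD:
  assumes "cand J' j0 p2 q2" "i0 \<le> p2"
  shows "p2 < p \<Longrightarrow> cand J j0 (Suc p2) (Suc q2)" "p2 = p \<Longrightarrow> q2 = s (Suc p)" "p < p2 \<Longrightarrow> cand J j0 p2 q2"
proof -
  assume lt: "p2 < p"
  have "(Suc p2, j0) \<in> D"
    using P(7)[of p2] D_mono[of "Suc p2" "s (Suc p2)" "Suc p2" j0] lt assms(2) j0 s_ge[of "Suc p2"] by simp
  then show "cand J j0 (Suc p2) (Suc q2)"
    using assms lt by (auto simp: cand_def bump_def)
next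
  assume "p2 = p"
  then show "q2 = s (Suc p)" using assms(1) s_ge[of "Suc p"] P(1) by (auto simp: cand_def bump_def)
next
  assume "p < p2"
  then show "cand J j0 p2 q2" using assms by (auto simp: cand_def bump_def)
qed

text \<open>Below row \<open>p\<close> the fillings agree, so only the crossing from row
  \<open>Suc p\<close> to row \<open>p\<close> has to be compared; to the right of
  \<open>s (Suc p)\<close> row \<open>p\<close> is unchanged too, so no new crossing arises
  there.\<close>

lemma above_candidate':
  assumes "cand J' j0 p2 q2" "p < p2"
  shows "rev_col T' j0 q2 p2 (Suc p) \<le> s (Suc p)"
proof -
  let ?y = "rev_col T j0 q2 p2 (Suc (Suc p))"
  have c: "cand J j0 p2 q2" using cand_bumpD(3) assms P(1) by simp
  have below: "T' (i, j) = T (i, j)" if "Suc p \<le> i" for i j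
    using that by (intro T'_off) (auto simp: on_path_def)
  have y: "rev_col T' j0 q2 p2 (Suc (Suc p)) = ?y"
    using below assms by (intro rev_col_cong) auto
  have "rev_col T j0 q2 p2 (Suc p) \<le> s p"
    using above_candidate[OF c, of p] P(1) assms(2) by simp
  then have le: "cross_col T j0 (Suc p) ?y \<le> s (Suc p)"
    using rev_col_rec[of "Suc p" p2 T j0 q2] P(1) P(3)[of p] assms(2) by simp
  have "cross_col T' j0 (Suc p) ?y \<le> s (Suc p)"
  proof (rule cross_col_le)
    show "j0 \<le> ?y" using rev_col_bounds[of j0 q2 "Suc (Suc p)" p2 T] cand_ge[OF c] assms(2) by simp
    show "j0 \<le> s (Suc p)" using s_ge P(1) by simp
    fix j assume j: "s (Suc p) < j" "j \<le> ?y"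
    then have "\<not> T (Suc p, j - 1) < T (Suc p - 1, j)"
      using le s_ge[of "Suc p"] P(1) by (intro not_cross[of T j0 "Suc p" ?y j]) auto
    moreover have "T' (p, j) = T (p, j)" using j by (intro T'_off) (auto simp: on_path_def)
    ultimately show "\<not> T' (Suc p, j - 1) < T' (Suc p - 1, j)" using below by simp
  qed
  then show ?thesis using rev_col_rec[of "Suc p" p2 T' j0 q2] assms(2) y by simp
qed

lemma T'_topmost: "topmost T' J' i0 j0 p (s (Suc p))"
  unfolding topmost_def
proof (intro conjI allI impI; (elim conjE)?)
  show "i0 \<le> p" by (rule P(1))
  have "(p, j0) \<in> D" using end_in_D D_mono[of p "s (Suc p)" p j0] P(1) j0 s_ge[of "Suc p"] by simp
  then show "cand J' j0 p (s (Suc p))" using s_ge[of "Suc p"] P(1) by (simp add: cand_def bump_def)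
next
  fix p2 q2 assume h: "i0 \<le> p2" "p2 < p" "cand J' j0 p2 q2"
  have "cand J j0 (Suc p2) (Suc q2)" using cand_bumpD h by blast
  from above_candidate[OF this, of "Suc p2"] h
  show "q2 < rev_col T' j0 (s (Suc p)) p (Suc p2)" by (simp add: rev_col_start rev_col_T')
next
  fix p2 q2 assume "p < p2" "cand J' j0 p2 q2"
  then show "rev_col T' j0 q2 p2 (Suc p) \<le> s (Suc p)" using above_candidate' by blast
qed

text \<open>The slide path is the reverse path from its own end and lies above all others. It
  reaches row \<open>i0\<close> in column \<open>j0\<close>, so the others, being squeezed between
  it and column \<open>j0\<close>, do so too.\<close>

lemma T'_inv:
  assumes "i0 \<le> p2" "cand J' j0 p2 q2"
  shows "rev_col T' j0 q2 p2 i0 = j0"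
proof -
  define k where "k = Suc (min p p2)"
  have k: "i0 \<le> k" "k \<le> Suc p" "k \<le> Suc p2" using P(1) assms(1) by (auto simp: k_def)
  have "rev_col T' j0 q2 p2 k \<le> rev_col T' j0 (s (Suc p)) p k"
  proof (cases p2 p rule: linorder_cases)
    case less
    then show ?thesis using T'_topmost assms by (auto simp: k_def topmost_def rev_col_start less_imp_le)
  next
    case equal
    then show ?thesis using cand_bumpD(2) assms by auto
  next
    case greater
    then show ?thesis using above_candidate' assms by (simp add: k_def rev_col_start)
  qed
  then have "rev_col T' j0 q2 p2 i0 \<le> rev_col T' j0 (s (Suc p)) p i0"
    using k s_ge[of "Suc p"] P(1) cand_ge[OF assms(2)] by - (rule rev_col_mono[where k = k]; auto)
  then show ?thesis
    using rev_col_T'[of i0] P(1,2) rev_col_bounds[of j0 q2 i0 p2 T'] cand_ge[OF assms(2)] assms(1)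
    by simp
qed

text \<open>One row up, the leg is longer by one and the arm is not shorter, so a value decreased by
  one stays in range. The new value in row \<open>p\<close> is at most the arm because the slide
  ended inside row \<open>p\<close>.\<close>

lemma J'_PiE: "J' \<in> (\<Pi>\<^sub>E c\<in>after m j0. {- leg c..arm c})"
proof (rule PiE_I)
  fix c assume c: "c \<in> after m j0"
  obtain i j where ij: "c = (i, j)" by fastforce
  show "J' c \<in> {- leg c..arm c}"
  proof (cases "j = j0 \<and> i0 \<le> i \<and> i \<le> p")
    case False
    then have "c \<in> W" using c P(1) by (auto simp: ij after_def)
    moreover have "J' c = J c" using False P(1) by (auto simp: ij bump_def)
    ultimately show ?thesis using PiE_mem[OF J, of c] by simp
  next
    case True
    show ?thesis
    proof (cases "i = p")
      case True
      have "(p, j0) \<in> D"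
        using D_mono[OF end_in_D, of p j0] j0 P(1) s_ge[of "Suc p"] by simp
      then have "p \<le> conj_part lam j0" using mem_D_column[OF j0] by blast
      moreover have "s (Suc p) \<le> part lam p" using end_in_D by (simp add: mem_D)
      moreover have "J' c = int (s (Suc p)) - int j0"
        using True \<open>j = j0 \<and> i0 \<le> i \<and> i \<le> p\<close> by (simp add: ij bump_def)
      ultimately show ?thesis
        using True \<open>j = j0 \<and> i0 \<le> i \<and> i \<le> p\<close> s_ge[of "Suc p"] P(1)
        by (simp add: ij arm_def leg_def)
    next
      case False
      then have "(Suc i, j0) \<in> D"
        using D_mono[OF P(7)[of i], of "Suc i" j0] True j0 s_ge[of "Suc i"] by simp
      then have "(Suc i, j0) \<in> W" using True by (simp add: after_def)
      then have "J (Suc i, j0) \<in> {- leg (Suc i, j0)..arm (Suc i, j0)}" by (rule PiE_mem[OF J])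
      moreover have "part lam (Suc i) \<le> part lam i" using part_antimono True by simp
      moreover have "J' c = J (Suc i, j0) - 1" using True False by (simp add: ij bump_def)
      ultimately show ?thesis using True by (simp add: ij arm_def leg_def)
    qed
  qed
next
  fix c assume c: "c \<notin> after m j0"
  have col: "(i, j0) \<in> after m j0" if "i0 \<le> i" "i \<le> p" for i
    using D_mono[OF end_in_D, of i j0] that j0 s_ge[of "Suc p"] by (simp add: after_def)
  have "J' c = J c" using c col[of "fst c"] P(1) by (auto simp: bump_def split: prod.splits)
  also have "\<dots> = undefined" using c W_eq PiE_arb[OF J, of c] by blast
  finally show "J' c = undefined" .
qed

lemma forward_state: "(T', J') \<in> state m j0"
  using T'_tabloid T'_increasing J'_PiE T'_inv by (auto simp: state_def Suc_le_eq)

lemma unshift_T': "unshift_path i0 p s T' = T"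
  using P(1,3) by (rule unshift_shift_path)

lemma unbump_J': "unbump i0 j0 p J' = J"
  using P(1) J by (intro unbump_bump) (auto simp: after_def PiE_def extensional_def)

end

section \<open>The backward step: undoing the slide that ended in the topmost candidate\<close>

lemma on_path_left:
  "i0 \<le> i \<Longrightarrow> i \<le> p \<Longrightarrow> s i < j \<Longrightarrow> j \<le> s (Suc i) \<Longrightarrow> on_path i0 p s (i, j - 1)"
  by (auto simp: on_path_def)

lemma on_path_up:
  assumes "\<And>i. i0 \<le> i \<Longrightarrow> i \<le> p \<Longrightarrow> s i \<le> s (Suc i)" "i0 < i" "i \<le> p"
  shows "on_path i0 p s (i - 1, s i)"
  using assms(1)[of "i - 1"] assms(2,3) by (cases i) (auto simp: on_path_def)

locale backward_step = partition +
  fixes T' :: filling and J' :: "cell \<Rightarrow> int" and m j0 p q :: nat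
  assumes TJ': "(T', J') \<in> state m j0"
    and z_in_D: "(Suc m, j0) \<in> D"
    and top: "topmost T' J' (Suc m) j0 p q"
begin

abbreviation "i0 \<equiv> Suc m"
abbreviation "W \<equiv> after i0 j0"
abbreviation "s \<equiv> rev_col T' j0 q p"
abbreviation "T \<equiv> unshift_path i0 p s T'"
abbreviation "J \<equiv> unbump i0 j0 p J'"

lemma T': "T' \<in> tabloids lam" "increasing_on (after m j0) T'"
  and J': "J' \<in> (\<Pi>\<^sub>E c\<in>after m j0. {- leg c..arm c})"
  and inv: "\<And>p q. m < p \<Longrightarrow> cand J' j0 p q \<Longrightarrow> rev_col T' j0 q p i0 = j0"
  using TJ' by (auto simp: state_def)

lemma i0_le_p: "i0 \<le> p" and cand_p: "cand J' j0 p q"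
  and above: "\<And>p2 q2. i0 \<le> p2 \<Longrightarrow> p2 < p \<Longrightarrow> cand J' j0 p2 q2 \<Longrightarrow> q2 < s (Suc p2)"
  and below: "\<And>p2 q2. p < p2 \<Longrightarrow> cand J' j0 p2 q2 \<Longrightarrow> rev_col T' j0 q2 p2 (Suc p) \<le> q"
  using top unfolding topmost_def by blast+

lemma j0: "1 \<le> j0" using z_in_D by (simp add: mem_D)

lemma s_end: "s (Suc p) = q" by (rule rev_col_start)

lemma s_start: "s i0 = j0"
  using inv[OF _ cand_p] i0_le_p by simp

lemma s_Suc: "i0 \<le> i \<Longrightarrow> i \<le> p \<Longrightarrow> s i \<le> s (Suc i)"
  using rev_col_bounds[OF cand_ge[OF cand_p], of i p T'] by simp

lemma s_ge: "i \<le> Suc p \<Longrightarrow> j0 \<le> s i"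
  using rev_col_bounds[OF cand_ge[OF cand_p], of i p T'] by simp

lemma end_in_D: "(p, q) \<in> D"
  using cand_in_D[OF cand_p J'] i0_le_p by simp

lemma W_eq: "after m j0 = insert (i0, j0) W"
  using after_Suc z_in_D by simp

lemma on_pathD:
  assumes "on_path i0 p s (i, j)"
  shows "(i, j) \<in> D" "j0 \<le> j" "(i, j) = (i0, j0) \<or> (i, j) \<in> W" "(i, j) \<in> after m j0"
  using path_in_D[of p s i0 i j] assms end_in_D s_end s_start j0 s_Suc W_eq by auto

lemma turn:
  assumes "i0 < i" "i \<le> p" "j0 < s i"
  shows "T' (i, s i - 1) < T' (i - 1, s i)"
  using cross_col_bounds(3)[of j0 "s (Suc i)" T' i] assms s_ge[of "Suc i"] rev_col_rec[of i p T' j0 q]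
  by simp

text \<open>\<open>not_cross\<close> gives the weak inequality. Equality is excluded since the
  entries in \<open>D\<close> are distinct and positive, while the values outside are 0.\<close>

lemma straight:
  assumes "i0 \<le> i" "i \<le> p" "s i < j" "j \<le> s (Suc i)"
  shows "T' (i - 1, j) < T' (i, j - 1)"
proof -
  have on: "on_path i0 p s (i, j)" "on_path i0 p s (i, j - 1)"
    using assms on_path_left by (simp_all add: on_path_def)
  have "\<not> T' (i, j - 1) < T' (i - 1, j)"
    using not_cross[of T' j0 i "s (Suc i)" j] assms s_ge[of i] rev_col_rec[of i p T' j0 q] by simp
  moreover have "T' (i, j - 1) \<noteq> T' (i - 1, j)"
  proof (cases "(i - 1, j) \<in> D")
    case True
    then show ?thesis
      using inj_onD[OF tabloid_inj[OF T'(1)], of "(i, j - 1)" "(i - 1, j)"] on_pathD(1)[OF on(2)] assms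
      by auto
  next
    case False
    have "T' (i, j - 1) \<in> {1..n}"
      using T'(1) on_pathD(1)[OF on(2)] unfolding tabloids_iff by (blast dest: bij_betwE)
    moreover have "T' (i - 1, j) = 0" using T'(1) False by (simp add: tabloids_iff)
    ultimately show ?thesis by simp
  qed
  ultimately show ?thesis by simp
qed

lemma T_left: "i0 \<le> i \<Longrightarrow> i \<le> p \<Longrightarrow> s i < j \<Longrightarrow> j \<le> s (Suc i) \<Longrightarrow> T (i, j) = T' (i, j - 1)"
  by (simp add: unshift_path_def on_path_def)

lemma T_up: "i0 < i \<Longrightarrow> i \<le> p \<Longrightarrow> T (i, s i) = T' (i - 1, s i)"
  using s_Suc[of i] by (simp add: unshift_path_def on_path_def)

lemma T_start: "T (i0, j0) = T' (p, q)"
  using i0_le_p s_Suc[of i0] s_start s_end by (simp add: unshift_path_def on_path_def)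

lemma T_off: "\<not> on_path i0 p s c \<Longrightarrow> T c = T' c"
  by (cases c) (simp add: unshift_path_def)

lemma on_path_cases [consumes 1]:
  assumes "on_path i0 p s (i, j)"
  obtains (left) "i0 \<le> i" "i \<le> p" "s i < j" "j \<le> s (Suc i)"
    | (up) "i0 < i" "i \<le> p" "j = s i" "j \<le> s (Suc i)"
    | (start) "i = i0" "j = j0"
  using assms s_start by (fastforce simp: on_path_def le_less)

lemma T_smaller:
  assumes "on_path i0 p s (i, j)" "(i, j) \<noteq> (i0, j0)"
  shows "T (i, j) < T' (i, j)"
  using assms(1)
proof (cases rule: on_path_cases)
  case left
  then have "on_path i0 p s (i, j - 1)" by (rule on_path_left)
  then show ?thesis using on_pathD(4)[of i "j - 1"] on_pathD(4)[OF assms(1)] left T_left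
      increasing_onD(1)[OF T'(2), of i "j - 1"] by simp
next
  case up
  then have "on_path i0 p s (i - 1, j)" using on_path_up[of i0 p s i] s_Suc by simp
  then show ?thesis using on_pathD(4)[of "i - 1" j] on_pathD(4)[OF assms(1)] up T_up
      increasing_onD(2)[OF T'(2), of "i - 1" j] by simp
qed (use assms in simp)

text \<open>Entries of \<open>W\<close> can only decrease, so the critical pairs are those with the
  second cell on the path. For these, \<open>turn\<close> and \<open>straight\<close> compare
  precisely the entries that meet, or the second cell receives the old entry of the first, which
  itself has decreased.\<close>

lemma T_increasing: "increasing_on W T"
  unfolding increasing_on_def
proof (intro conjI allI impI; elim conjE)
  fix i j assume h: "(i, j) \<in> W" "(i, Suc j) \<in> W"
  have inc: "T' (i, j) < T' (i, Suc j)"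
    using increasing_onD(1)[OF T'(2)] h W_eq by simp
  have nz: "(i, j) \<noteq> (i0, j0)" "(i, Suc j) \<noteq> (i0, j0)" using h not_in_after by metis+
  have c: "T (i, j) \<le> T' (i, j)"
    using T_smaller[OF _ nz(1)] T_off[of "(i, j)"] by fastforce
  show "T (i, j) < T (i, Suc j)"
  proof (cases "on_path i0 p s (i, Suc j)")
    case False
    then show ?thesis using c inc T_off by simp
  next
    case True
    then show ?thesis
    proof (cases rule: on_path_cases)
      case left
      then have "on_path i0 p s (i, j)" by (simp add: on_path_def)
      then show ?thesis using T_smaller nz T_left left by simp
    next
      case up
      then have "j0 \<le> j" using h(1) by (auto simp: after_def)
      then have "T' (i, j) < T' (i - 1, Suc j)" using turn[of i] up(1,2) unfolding up(3)[symmetric] by simp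
      then show ?thesis using c T_up[of i] up(1,2) unfolding up(3)[symmetric] by simp
    qed (use nz in simp)
  qed
next
  fix i j assume h: "(i, j) \<in> W" "(Suc i, j) \<in> W"
  have inc: "T' (i, j) < T' (Suc i, j)"
    using increasing_onD(2)[OF T'(2)] h W_eq by simp
  have nz: "(i, j) \<noteq> (i0, j0)" "(Suc i, j) \<noteq> (i0, j0)" using h not_in_after by metis+
  have c: "T (i, j) \<le> T' (i, j)"
    using T_smaller[OF _ nz(1)] T_off[of "(i, j)"] by fastforce
  show "T (i, j) < T (Suc i, j)"
  proof (cases "on_path i0 p s (Suc i, j)")
    case False
    then show ?thesis using c inc T_off by simp
  next
    case True
    then show ?thesis
    proof (cases rule: on_path_cases)
      case left
      then show ?thesis using straight[of "Suc i" j] T_left c by simp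
    next
      case up
      then have "on_path i0 p s (i, j)" using s_Suc[of i] by (simp add: on_path_def)
      then show ?thesis using T_smaller nz T_up up by simp
    qed (use nz in simp)
  qed
qed

lemma shift_T: "shift_path i0 p s T = T'"
  using i0_le_p s_Suc by (rule shift_unshift_path)

text \<open>Each of the two fillings takes its entries from cells of \<open>D\<close> in the other,
  so they have the same values on \<open>D\<close>; injectivity follows by counting.\<close>

lemma T_tabloid: "T \<in> tabloids lam"
proof -
  have "T c \<in> T' ` D" if "c \<in> D" for c
  proof (cases "on_path i0 p s c")
    case True
    obtain i j where c: "c = (i, j)" by fastforce
    from True[unfolded c] show ?thesis
    proof (cases rule: on_path_cases)
      case left
      then have "on_path i0 p s (i, j - 1)" by (rule on_path_left)
      then have "(i, j - 1) \<in> D" by (rule on_pathD(1))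
      then show ?thesis using T_left[OF left] c by simp
    next
      case up
      then have "on_path i0 p s (i - 1, j)" using on_path_up[of i0 p s i] s_Suc by simp
      then have "(i - 1, j) \<in> D" by (rule on_pathD(1))
      then show ?thesis using T_up[of i] up c by simp
    next
      case start
      then show ?thesis using T_start end_in_D c by simp
    qed
  qed (use that T_off in simp)
  moreover have "T' c \<in> T ` D" if "c \<in> D" for c
  proof -
    have "(i, Suc j) \<in> D" if "on_path i0 p s (i, j)" "j < s (Suc i)" for i j
      using that on_pathD(1)[of i "Suc j"] by (simp add: on_path_def)
    moreover have "(Suc i, j) \<in> D" if "on_path i0 p s (i, j)" "\<not> j < s (Suc i)" "i < p" for i j
      using that on_pathD(1)[of "Suc i" j] s_Suc[of "Suc i"] by (simp add: on_path_def)
    ultimately have "shift_path i0 p s T c \<in> T ` D"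
      using that z_in_D s_start unfolding shift_path_def by (auto split: prod.splits)
    then show ?thesis by (simp add: shift_T)
  qed
  ultimately have "T ` D = T' ` D" by blast
  then have im: "T ` D = {1..n}" using T'(1) by (simp add: tabloids_iff bij_betw_def)
  moreover have "inj_on T D"
    using im card_D by (intro eq_card_imp_inj_on) auto
  moreover have "T c = 0" if "c \<notin> D" for c
    using that T'(1) T_off[of c] on_pathD(1) by (cases c) (auto simp: tabloids_iff)
  ultimately show ?thesis by (simp add: tabloids_iff bij_betw_def)
qed

lemma T'_less_end:
  assumes "on_path i0 p s (i, j)" "(i, j) \<noteq> (p, q)"
  shows "T' (i, j) < T' (p, q)"
proof -
  have h: "i0 \<le> i" "i \<le> p" "j \<le> s (Suc i)" using assms(1) by (auto simp: on_path_def)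
  then have "j \<le> q" using path_mono[of i0 p s "Suc i" "Suc p"] s_Suc s_end by simp
  then have "T' (i, j) \<le> T' (p, q)"
    using increasing_on_after_mono[OF T'(2) on_pathD(4)[OF assms(1)] end_in_D] h by simp
  moreover have "T' (i, j) \<noteq> T' (p, q)"
    using inj_onD[OF tabloid_inj[OF T'(1)]] on_pathD(1)[OF assms(1)] end_in_D assms(2) by blast
  ultimately show ?thesis by simp
qed

text \<open>The entries met by the slide in \<open>T\<close> are those of \<open>T'\<close> one cell
  earlier on the path. As \<open>T'\<close> is increasing, they are smaller than their competitors
  off the path, and the moved entry \<open>T' (p, q)\<close> is the largest on the path.\<close>

lemma T_path: "slide_path D T (T (i0, j0)) i0 j0 p s"
  unfolding slide_path_def
proof (intro conjI allI impI; (elim conjE)?)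
  show "i0 \<le> p" "s i0 = j0" by (rule i0_le_p, rule s_start)
  show "s i \<le> s (Suc i)" if "i0 \<le> i" "i \<le> p" for i using s_Suc that .
next
  fix i j assume h: "i0 \<le> i" "i \<le> p" "s i \<le> j" "j < s (Suc i)"
  then have on: "on_path i0 p s (i, j)" "on_path i0 p s (i, Suc j)" by (auto simp: on_path_def)
  have eq: "T (i, Suc j) = T' (i, j)" using T_left h by simp
  show "(i, Suc j) \<in> D" using on_pathD(1) on by blast
  have "(i, j) \<noteq> (p, q)" using h s_end by auto
  then show "T (i, Suc j) < T (i0, j0)" using T'_less_end on eq T_start by simp
  assume d: "(Suc i, j) \<in> D"
  have "\<not> on_path i0 p s (Suc i, j)" using h by (simp add: on_path_def)
  then have "T (Suc i, j) = T' (Suc i, j)" by (rule T_off)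
  moreover have "(Suc i, j) \<in> after m j0" using d on_pathD(4)[OF on(1)] by (auto simp: after_def)
  ultimately show "T (i, Suc j) < T (Suc i, j)"
    using increasing_onD(2)[OF T'(2) on_pathD(4)[OF on(1)]] eq by simp
next
  fix i assume h: "i0 \<le> i" "i < p"
  then have on: "on_path i0 p s (i, s (Suc i))" "on_path i0 p s (Suc i, s (Suc i))"
    using s_Suc[of i] s_Suc[of "Suc i"] by (auto simp: on_path_def)
  have eq: "T (Suc i, s (Suc i)) = T' (i, s (Suc i))" using T_up h by simp
  show "(Suc i, s (Suc i)) \<in> D" using on_pathD(1) on by blast
  show "T (Suc i, s (Suc i)) < T (i0, j0)" using T'_less_end on eq T_start h by simp
  assume d: "(i, Suc (s (Suc i))) \<in> D"
  have "\<not> on_path i0 p s (i, Suc (s (Suc i)))" by (simp add: on_path_def)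
  then have "T (i, Suc (s (Suc i))) = T' (i, Suc (s (Suc i)))" by (rule T_off)
  moreover have "(i, Suc (s (Suc i))) \<in> after m j0"
    using d on_pathD(4)[OF on(1)] by (auto simp: after_def)
  ultimately show "T (Suc i, s (Suc i)) < T (i, Suc (s (Suc i)))"
    using increasing_onD(1)[OF T'(2) on_pathD(4)[OF on(1)]] eq by simp
next
  have on: "on_path i0 p s (p, q)" using i0_le_p s_Suc[of p] s_end by (simp add: on_path_def)
  {
    assume d: "(p, Suc (s (Suc p))) \<in> D"
    have "\<not> on_path i0 p s (p, Suc q)" using s_end by (simp add: on_path_def)
    then have "T (p, Suc q) = T' (p, Suc q)" by (rule T_off)
    moreover have "(p, Suc q) \<in> after m j0" using d on_pathD(4)[OF on] s_end by (auto simp: after_def)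
    ultimately show "\<not> T (p, Suc (s (Suc p))) < T (i0, j0)"
      using increasing_onD(1)[OF T'(2) on_pathD(4)[OF on]] T_start s_end by simp
  }
  {
    assume d: "(Suc p, s (Suc p)) \<in> D"
    have "\<not> on_path i0 p s (Suc p, q)" by (simp add: on_path_def)
    then have "T (Suc p, q) = T' (Suc p, q)" by (rule T_off)
    moreover have "(Suc p, q) \<in> after m j0" using d on_pathD(4)[OF on] s_end by (auto simp: after_def)
    ultimately show "\<not> T (Suc p, s (Suc p)) < T (i0, j0)"
      using increasing_onD(2)[OF T'(2) on_pathD(4)[OF on]] T_start s_end by simp
  }
qed

lemma column_in_D: "i0 \<le> i \<Longrightarrow> i \<le> p \<Longrightarrow> (i, j0) \<in> D"
  using D_mono[OF end_in_D, of i j0] j0 cand_ge[OF cand_p] by simp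

lemma J_at: "i0 < i \<Longrightarrow> i \<le> p \<Longrightarrow> J (i, j0) = J' (i - 1, j0) + 1"
  by (simp add: unbump_def)

text \<open>A nonnegative value in row \<open>i - 1\<close> marks a candidate above row
  \<open>p\<close>, which must end strictly to the left of column \<open>s i\<close> since
  \<open>(p, q)\<close> is topmost. The strictness pays for the increase by one in
  \<open>unbump\<close>.\<close>

lemma J_bound:
  assumes "i0 < i" "i \<le> p"
  shows "int j0 + J (i, j0) \<le> int (s i)"
proof (cases "J' (i - 1, j0) \<ge> 0")
  case True
  then have "cand J' j0 (i - 1) (j0 + nat (J' (i - 1, j0)))"
    using column_in_D[of "i - 1"] assms by (simp add: cand_def)
  then have "j0 + nat (J' (i - 1, j0)) < s i" using above[of "i - 1"] assms by simp
  then show ?thesis using True J_at assms by simp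
next
  case False
  then show ?thesis using J_at[OF assms] s_ge[of i] assms by simp
qed

lemma J_PiE: "J \<in> (\<Pi>\<^sub>E c\<in>W. {- leg c..arm c})"
proof (rule PiE_I)
  fix c assume c: "c \<in> W"
  obtain i j where ij: "c = (i, j)" by fastforce
  show "J c \<in> {- leg c..arm c}"
  proof (cases "j = j0 \<and> i0 < i \<and> i \<le> p")
    case False
    then have "J c = J' c" using c by (auto simp: ij unbump_def after_def)
    then show ?thesis using PiE_mem[OF J', of c] c W_eq by simp
  next
    case True
    have "(i - 1, j0) \<in> after m j0" using True column_in_D[of "i - 1"] by (auto simp: after_def)
    then have "J' (i - 1, j0) \<in> {- leg (i - 1, j0)..arm (i - 1, j0)}" by (rule PiE_mem[OF J'])
    moreover have "(i, s i) \<in> D"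
      using on_pathD(1)[of i "s i"] True s_Suc[of i] by (simp add: on_path_def)
    ultimately show ?thesis
      using J_bound[of i] J_at[of i] True by (auto simp: ij arm_def leg_def mem_D)
  qed
next
  fix c assume c: "c \<notin> W"
  then have "c \<notin> after m j0 \<or> c = (i0, j0)" using W_eq by blast
  moreover have "\<not> (snd c = j0 \<and> i0 < fst c \<and> fst c \<le> p)"
    using c column_in_D[of "fst c"] by (cases c) (auto simp: after_def)
  ultimately show "J c = undefined"
    using PiE_arb[OF J', of c] by (cases c) (auto simp: unbump_def)
qed

lemma T_inv:
  assumes "i0 < p2" "cand J j0 p2 q2"
  shows "rev_col T j0 q2 p2 (Suc i0) = j0"
proof -
  let ?x = "rev_col T j0 q2 p2"
  have x_ge: "j0 \<le> ?x i" if "i \<le> Suc p2" for i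
    using rev_col_bounds[OF cand_ge[OF assms(2)] that] by blast
  \<comment> \<open>The aim is \<open>?x (Suc i) \<le> s i\<close> for all rows up to
    \<open>min p p2\<close>; row \<open>i0\<close> gives the result. In the base row this is
    \<open>J_bound\<close> if the candidate starts in row \<open>p\<close> or higher, and otherwise
    follows from \<open>below\<close>.\<close>
  have base: "?x (Suc (min p p2)) \<le> s (min p p2)"
  proof (cases "p2 \<le> p")
    case True
    then have "q2 \<le> s p2" using J_bound[of p2] assms by (auto simp: cand_def)
    moreover have "min p p2 = p2" using True by simp
    ultimately show ?thesis by (simp only: rev_col_start)
  next
    case False
    let ?y = "?x (Suc (Suc p))"
    have c': "cand J' j0 p2 q2" using assms False by (simp add: cand_def unbump_def)
    have low: "T (i, j) = T' (i, j)" if "Suc p \<le> i" for i j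
      using that by (intro T_off) (auto simp: on_path_def)
    have y: "rev_col T' j0 q2 p2 (Suc (Suc p)) = ?y"
      using low False by (intro rev_col_cong[symmetric]) auto
    have "cross_col T' j0 (Suc p) ?y \<le> q"
      using below[OF _ c'] rev_col_rec[of "Suc p" p2 T' j0 q2] False y by simp
    have "cross_col T j0 (Suc p) ?y \<le> s p"
    proof (rule cross_col_le)
      show "j0 \<le> ?y" using x_ge False by simp
      show "j0 \<le> s p" using s_ge by simp
      fix j assume j: "s p < j" "j \<le> ?y"
      show "\<not> T (Suc p, j - 1) < T (Suc p - 1, j)"
      proof (cases "j \<le> q")
        case True
        have "?y \<le> q2"
          using rev_col_bounds[OF cand_ge[OF assms(2)], of "Suc (Suc p)" p2 T,
              THEN conjunct2, THEN spec, of "Suc p2"] False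
          by (simp add: rev_col_start)
        then have "(Suc p, j - 1) \<in> D"
          using D_mono[OF cand_in_D[OF c' J'], of "Suc p" "j - 1"] False j s_ge[of p] j0 i0_le_p by simp
        moreover have *: "(p, j - 1) \<in> after m j0"
          using on_pathD(4)[OF on_path_left[of i0 p p s j]] j i0_le_p True s_end by simp
        ultimately have "(Suc p, j - 1) \<in> after m j0" by (auto simp: after_def)
        then have "T' (p, j - 1) < T' (Suc p, j - 1)" using increasing_onD(2)[OF T'(2)] * by blast
        then show ?thesis using T_left[of p j] i0_le_p j True s_end low by simp
      next
        case gt: False
        then have "\<not> T' (Suc p, j - 1) < T' (Suc p - 1, j)"
          using \<open>cross_col T' j0 (Suc p) ?y \<le> q\<close> j cand_ge[OF cand_p]
          by (intro not_cross[of T' j0 "Suc p" ?y]) auto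
        moreover have "T (p, j) = T' (p, j)"
          using gt s_end by (intro T_off) (simp add: on_path_def)
        ultimately show ?thesis using low by simp
      qed
    qed
    then show ?thesis using False rev_col_rec[of "Suc p" p2 T j0 q2] by (simp add: min_def)
  qed
  have "?x (Suc i) \<le> s i" if "i0 \<le> i" "i \<le> min p p2" for i
    using that(2,1)
  proof (induction i rule: inc_induct)
    case (step i)
    have lt: "i < p" "i < p2" using step.hyps by auto
    \<comment> \<open>In the columns \<open>j\<close> between \<open>s i\<close> and
      \<open>s (Suc i)\<close>, \<open>T (i, j)\<close> is \<open>T' (i, j - 1)\<close>, the entry
      directly above \<open>T' (Suc i, j - 1)\<close>. So the reverse path cannot cross into row
      \<open>i\<close> there.\<close>
    have "cross_col T j0 (Suc i) (?x (Suc (Suc i))) \<le> s i"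
    proof (rule cross_col_le)
      show "j0 \<le> ?x (Suc (Suc i))" using x_ge lt by simp
      show "j0 \<le> s i" using s_ge lt by simp
      fix j assume j: "s i < j" "j \<le> ?x (Suc (Suc i))"
      then have j': "j \<le> s (Suc i)" using step by simp
      have "(Suc i, s (Suc i)) \<in> D"
        using on_pathD(1)[of "Suc i" "s (Suc i)"] s_Suc[of "Suc i"] step.prems lt
        by (simp add: on_path_def)
      then have "(Suc i, j - 1) \<in> D"
        using D_mono[of "Suc i" "s (Suc i)" "Suc i" "j - 1"] j j' s_ge[of i] j0 lt by simp
      moreover have *: "(i, j - 1) \<in> after m j0"
        using on_pathD(4)[OF on_path_left[of i0 i p s j]] j j' step.prems lt by simp
      ultimately have "(Suc i, j - 1) \<in> after m j0" by (auto simp: after_def)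
      then have "T' (i, j - 1) < T' (Suc i, j - 1)" using increasing_onD(2)[OF T'(2)] * by blast
      moreover have "T (Suc i, j - 1) = T' (Suc i, j - 1)"
        using j j' by (intro T_off) (auto simp: on_path_def)
      ultimately show "\<not> T (Suc i, j - 1) < T (Suc i - 1, j)"
        using T_left[of i j] step.prems lt j j' by simp
    qed
    then show ?case using rev_col_rec[of "Suc i" p2 T j0 q2] lt by simp
  qed (rule base)
  then have "?x (Suc i0) \<le> j0" using i0_le_p assms(1) s_start by fastforce
  then show ?thesis using x_ge[of "Suc i0"] assms(1) by simp
qed

lemma backward_state: "(T, J) \<in> state i0 j0"
  using T_tabloid T_increasing J_PiE T_inv by (auto simp: state_def)

lemma bump_J: "bump i0 j0 p q J = J'"
  using i0_le_p cand_p by (intro bump_unbump) (auto simp: cand_def)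

end

section \<open>The forward and the backward step are mutually inverse\<close>

context partition
begin

text \<open>A slide path determines \<open>s\<close> only between \<open>i0\<close> and
  \<open>Suc p\<close>, hence the choice by \<open>SOME\<close>; by \<open>slide_path_unique\<close>
  the values \<open>p\<close> and \<open>s (Suc p)\<close> used here do not depend on it.\<close>

definition step :: "cell \<Rightarrow> filling \<times> (cell \<Rightarrow> int) \<Rightarrow> filling \<times> (cell \<Rightarrow> int)" where
  "step z = (\<lambda>(T, J). (slide lam T z,
     let (p, s) = (SOME (p, s). slide_path D T (T z) (fst z) (snd z) p s)
     in bump (fst z) (snd z) p (s (Suc p)) J))"

definition unstep :: "cell \<Rightarrow> filling \<times> (cell \<Rightarrow> int) \<Rightarrow> filling \<times> (cell \<Rightarrow> int)" where
  "unstep z = (\<lambda>(T, J). let (p, q) = (SOME (p, q). topmost T J (fst z) (snd z) p q)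
     in (unshift_path (fst z) p (rev_col T (snd z) q p) T, unbump (fst z) (snd z) p J))"

lemma unstep_topmost:
  assumes "topmost T J i0 j0 p q"
  shows "unstep (i0, j0) (T, J) = (unshift_path i0 p (rev_col T j0 q p) T, unbump i0 j0 p J)"
proof -
  have "(SOME (p, q). topmost T J i0 j0 p q) = (p, q)"
    using assms topmost_unique by (intro some_equality) auto
  then show ?thesis by (simp add: unstep_def)
qed

lemma forward_stepI:
  assumes "(T, J) \<in> state (Suc m) j0" "(Suc m, j0) \<in> D"
  obtains p s where "forward_step lam n T J m j0 p s"
    "step (Suc m, j0) (T, J) = (shift_path (Suc m) p s T, bump (Suc m) j0 p (s (Suc p)) J)"
proof -
  let ?P = "\<lambda>(p, s). slide_path D T (T (Suc m, j0)) (Suc m) j0 p s"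
  obtain p s where eq: "(SOME x. ?P x) = (p, s)" by fastforce
  have "T \<in> tabloids lam" using assms(1) by (simp add: state_def)
  then have "\<exists>x. ?P x" using slide_path_exists[OF tabloid_inj finite_D assms(2)] by auto
  then have P: "?P (p, s)" using eq by (metis someI_ex)
  have "forward_step lam n T J m j0 p s"
    using P assms by unfold_locales auto
  moreover have "step (Suc m, j0) (T, J) = (shift_path (Suc m) p s T, bump (Suc m) j0 p (s (Suc p)) J)"
    using eq slide_eq_shift_path P assms(2) by (simp add: step_def)
  ultimately show ?thesis using that by blast
qed

lemma bij_betw_step:
  assumes "(Suc m, j0) \<in> D"
  shows "bij_betw (step (Suc m, j0)) (state (Suc m) j0) (state m j0)"
proof (rule bij_betw_byWitness[where f' = "unstep (Suc m, j0)"])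
  have fwd: "step (Suc m, j0) (T, J) \<in> state m j0 \<and> unstep (Suc m, j0) (step (Suc m, j0) (T, J)) = (T, J)"
    if "(T, J) \<in> state (Suc m) j0" for T J
  proof -
    from that assms obtain p s where F: "forward_step lam n T J m j0 p s"
      and eq: "step (Suc m, j0) (T, J) = (shift_path (Suc m) p s T, bump (Suc m) j0 p (s (Suc p)) J)"
      by (rule forward_stepI)
    interpret forward_step lam n T J m j0 p s by (rule F)
    have "unshift_path i0 p (rev_col T' j0 (s (Suc p)) p) T' = unshift_path i0 p s T'"
      using P(1) rev_col_T' by (rule path_cong)
    then show ?thesis
      using forward_state unstep_topmost[OF T'_topmost] unshift_T' unbump_J' eq by simp
  qed
  then show "\<forall>a\<in>state (Suc m) j0. unstep (Suc m, j0) (step (Suc m, j0) a) = a"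
    and "step (Suc m, j0) ` state (Suc m) j0 \<subseteq> state m j0" by auto
  have bwd: "unstep (Suc m, j0) (T', J') \<in> state (Suc m) j0 \<and>
      step (Suc m, j0) (unstep (Suc m, j0) (T', J')) = (T', J')"
    if h: "(T', J') \<in> state m j0" for T' J'
  proof -
    \<comment> \<open>The lowest cell of the column has leg 0, so its value is nonnegative and there
      is always a candidate.\<close>
    let ?r = "conj_part lam j0"
    have j: "1 \<le> j0" using assms by (simp add: mem_D)
    have r: "Suc m \<le> ?r" "(?r, j0) \<in> D"
      using assms by (simp_all add: mem_D_column[OF j])
    from h have "J' \<in> (\<Pi>\<^sub>E c\<in>after m j0. {- leg c..arm c})" by (simp add: state_def)
    moreover have "(?r, j0) \<in> after m j0" using r by (simp add: after_def)
    ultimately have "J' (?r, j0) \<in> {- leg (?r, j0)..arm (?r, j0)}" by (rule PiE_mem)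
    then have "0 \<le> J' (?r, j0)" by (simp add: leg_def)
    then have "cand J' j0 ?r (j0 + nat (J' (?r, j0)))" using r by (simp add: cand_def)
    then obtain p q where top: "topmost T' J' (Suc m) j0 p q"
      using topmost_exists r(1) by blast
    interpret backward_step lam n T' J' m j0 p q
      using h assms top by unfold_locales
    obtain p2 s2 where F: "forward_step lam n T J m j0 p2 s2"
      and eq: "step (i0, j0) (T, J) = (shift_path i0 p2 s2 T, bump i0 j0 p2 (s2 (Suc p2)) J)"
      using forward_stepI[OF backward_state assms] by blast
    have "unstep (i0, j0) (T', J') = (T, J)" using unstep_topmost[OF top] by simp
    moreover have "step (i0, j0) (T, J) = (T', J')"
    proof -
      interpret F: forward_step lam n T J m j0 p2 s2 by (rule F)
      have u: "p2 = p" "\<And>i. i0 \<le> i \<Longrightarrow> i \<le> Suc p \<Longrightarrow> s2 i = s i"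
        using slide_path_unique[OF F.path T_path] by auto
      then have "shift_path i0 p2 s2 T = T'" using path_cong(2)[of i0 p s2 s T] i0_le_p shift_T by simp
      moreover have "s2 (Suc p2) = q" using u i0_le_p s_end by simp
      ultimately show ?thesis using eq u(1) bump_J by simp
    qed
    ultimately show ?thesis using backward_state by simp
  qed
  then show "\<forall>a'\<in>state m j0. step (Suc m, j0) (unstep (Suc m, j0) a') = a'"
    and "unstep (Suc m, j0) ` state m j0 \<subseteq> state (Suc m) j0" by auto
qed

end

section \<open>Sorted tabloids are uniformly distributed\<close>

lemma set_drop_strict_sorted:
  "sorted_wrt (<) xs \<Longrightarrow> q < length xs \<Longrightarrow> set (drop (Suc q) xs) = {y \<in> set xs. xs ! q < (y :: 'a :: linorder)}"
proof (induction xs arbitrary: q)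
  case (Cons x xs)
  show ?case
  proof (cases q)
    case 0
    then show ?thesis using Cons.prems by auto
  next
    case (Suc r)
    then have "x < xs ! r" using Cons.prems by simp
    then have "\<not> xs ! r < x" by (rule less_not_sym)
    then show ?thesis using Cons Suc by auto
  qed
qed simp

lemma card_bij_betw_zero_outside:
  assumes "finite A"
  shows "card {T :: 'a \<Rightarrow> nat. bij_betw T A {1..card A} \<and> (\<forall>x. x \<notin> A \<longrightarrow> T x = 0)} = fact (card A)"
proof -
  obtain e where e: "bij_betw e A {1..card A}"
    using finite_same_card_bij[OF assms, of "{1..card A}"] by auto
  let ?S = "{T :: 'a \<Rightarrow> nat. bij_betw T A {1..card A} \<and> (\<forall>x. x \<notin> A \<longrightarrow> T x = 0)}"
  have "bij_betw (\<lambda>\<pi> x. if x \<in> A then e (\<pi> x) else 0) {\<pi>. \<pi> permutes A} ?S"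
  proof (rule bij_betw_byWitness[where f' = "\<lambda>T x. if x \<in> A then inv_into A e (T x) else x"])
    show "\<forall>\<pi>\<in>{\<pi>. \<pi> permutes A}.
        (\<lambda>x. if x \<in> A then inv_into A e ((if x \<in> A then e (\<pi> x) else 0)) else x) = \<pi>"
      using e permutes_in_image
      by (fastforce simp: bij_betw_def fun_eq_iff inv_into_f_f permutes_not_in)
    show "\<forall>T\<in>?S. (\<lambda>x. if x \<in> A then e (if x \<in> A then inv_into A e (T x) else x) else 0) = T"
    proof (intro ballI ext)
      fix T x assume "T \<in> ?S"
      then show "(if x \<in> A then e (if x \<in> A then inv_into A e (T x) else x) else 0) = T x"
        using e bij_betwE[of T A] by (auto intro!: f_inv_into_f simp: bij_betw_def)
    qed
    show "(\<lambda>\<pi> x. if x \<in> A then e (\<pi> x) else 0) ` {\<pi>. \<pi> permutes A} \<subseteq> ?S"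
    proof safe
      fix \<pi> assume "\<pi> permutes A"
      then have "bij_betw (e \<circ> \<pi>) A {1..card A}"
        using e permutes_imp_bij bij_betw_trans by blast
      then show "bij_betw (\<lambda>x. if x \<in> A then e (\<pi> x) else 0) A {1..card A}"
        by (rule bij_betw_cong[THEN iffD1, rotated]) simp
    qed auto
    show "(\<lambda>T x. if x \<in> A then inv_into A e (T x) else x) ` ?S \<subseteq> {\<pi>. \<pi> permutes A}"
    proof safe
      fix T :: "'a \<Rightarrow> nat" assume "bij_betw T A {1..card A}"
      then have "bij_betw (inv_into A e \<circ> T) A A"
        using e bij_betw_inv_into bij_betw_trans by blast
      then have "bij_betw (\<lambda>x. if x \<in> A then inv_into A e (T x) else x) A A"
        by (rule bij_betw_cong[THEN iffD1, rotated]) simp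
      then show "(\<lambda>x. if x \<in> A then inv_into A e (T x) else x) permutes A"
        by (rule bij_imp_permutes) simp
    qed
  qed
  then have "card ?S = card {\<pi>. \<pi> permutes A}" by (simp add: bij_betw_same_card)
  then show ?thesis using card_permutations[OF refl assms] by simp
qed

section \<open>The chain of all steps and the sizes of its fibres\<close>

context partition
begin

abbreviation "L \<equiv> cells lam"
abbreviation "stage q T \<equiv> nps_stage lam T q"

text \<open>The only hook function as long as no cell has been processed.\<close>

abbreviation J0 :: "cell \<Rightarrow> int" where "J0 \<equiv> \<lambda>_. undefined"

lemma cells_eq: "L = map prod.swap (sorted_list_of_set (prod.swap ` D))"
proof -
  have "(\<lambda>(j, i). (i, j)) = (prod.swap :: nat \<times> nat \<Rightarrow> nat \<times> nat)" by auto
  then show ?thesis by (simp add: cells_def)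
qed

lemma set_cells: "set L = D" and distinct_cells: "distinct L" and length_cells: "length L = n"
  by (simp_all add: cells_eq image_image distinct_map card_image card_D)

lemma set_drop_cells:
  assumes "q < n" "L ! q = (i, j)"
  shows "set (drop (Suc q) L) = after i j"
proof -
  let ?xs = "sorted_list_of_set (prod.swap ` D)"
  have len: "q < length ?xs" using assms(1) length_cells by (simp add: cells_eq)
  have nth: "?xs ! q = (j, i)" using assms(2) len by (simp add: cells_eq prod.swap_def prod_eq_iff)
  have "set (drop (Suc q) L) = prod.swap ` set (drop (Suc q) ?xs)"
    by (simp add: cells_eq drop_map)
  also have "\<dots> = prod.swap ` {y \<in> prod.swap ` D. (j, i) < y}"
    using set_drop_strict_sorted[OF _ len] by (simp add: nth)
  also have "\<dots> = after i j"
    by (force simp: after_def less_prod_def)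
  finally show ?thesis .
qed

lemma cells_nth_in_D: "q < n \<Longrightarrow> L ! q \<in> D"
  using set_cells length_cells nth_mem by metis

lemma cells_nthE:
  assumes "q < n"
  obtains m j0 where "L ! q = (Suc m, j0)" "(Suc m, j0) \<in> D"
    "set (drop q L) = after m j0" "set (drop (Suc q) L) = after (Suc m) j0"
proof -
  obtain i j where ij: "L ! q = (i, j)" by fastforce
  then have "(i, j) \<in> D" using cells_nth_in_D[OF assms] by simp
  then obtain m where m: "i = Suc m" by (cases i) (auto simp: mem_D)
  have "set (drop (Suc q) L) = after (Suc m) j" using set_drop_cells assms ij m by blast
  moreover have "drop q L = L ! q # drop (Suc q) L"
    using assms length_cells by (simp add: Cons_nth_drop_Suc)
  ultimately show ?thesis
    using that[of m j] ij m \<open>(i, j) \<in> D\<close> after_Suc[of m j] by simp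
qed

text \<open>The last cell has no neighbour to its right or below. So the \<open>butlast\<close> in
  \<open>nps_stage\<close> makes no difference, and \<open>stage_Suc\<close> holds for all cells
  alike.\<close>

lemma slide_last:
  assumes "Suc q = n"
  shows "slide lam T (L ! q) = T"
proof -
  obtain i j where ij: "L ! q = (i, j)" by fastforce
  have "after i j = {}" using set_drop_cells[of q i j] assms ij length_cells by simp
  then have "(i, Suc j) \<notin> D" "(Suc i, j) \<notin> D" by (auto simp: after_def)
  then show ?thesis using assms by (cases "card D") (simp_all add: slide_def ij)
qed

lemma stage_n: "stage n T = T"
  using length_cells by (simp add: nps_stage_def)

lemma stage_Suc:
  assumes "q < n"
  shows "stage q T = slide lam (stage (Suc q) T) (L ! q)"
proof -
  have d: "drop q L = L ! q # drop (Suc q) L"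
    using assms length_cells by (simp add: Cons_nth_drop_Suc)
  show ?thesis
  proof (cases "Suc q = n")
    case True
    then show ?thesis using d slide_last length_cells by (simp add: nps_stage_def)
  next
    case False
    then have "drop (Suc q) L \<noteq> []" using assms length_cells by simp
    then show ?thesis unfolding nps_stage_def d by simp
  qed
qed

lemma nps_at_eq: "q < n \<Longrightarrow> nps_at lam T (L ! q) = stage q T"
  unfolding nps_at_def using distinct_cells length_cells
  by (auto intro!: arg_cong[of _ _ "nps_stage lam T"] simp: nth_eq_iff_index_eq)

text \<open>Row 0 contains only zeros, so no column qualifies for a crossing into it and the default
  \<open>j0\<close> results.\<close>

lemma rev_col_first_row:
  assumes "T \<in> tabloids lam" "j0 \<le> q" "1 \<le> p"
  shows "rev_col T j0 q p (Suc 0) = j0"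
proof -
  have "T (0, j) = 0" for j using assms(1) by (simp add: tabloids_iff mem_D)
  then have "cross_col T j0 (Suc 0) y = j0" if "j0 \<le> y" for y
    using that by (intro cross_col_eqI) auto
  then show ?thesis
    using rev_col_bounds[OF assms(2), of "Suc (Suc 0)" p T] assms(3) by (simp add: rev_col_rec)
qed

text \<open>Inside a column the indices coincide. Between two columns the condition on reverse paths
  holds on both sides: the new column has no candidates yet, and in the finished one the paths have
  reached the first row.\<close>

lemma state_link:
  assumes "after i j = after m j2" "(i, j) \<in> D" "(Suc m, j2) \<in> D" "(Suc m, j2) \<in> after i j"
  shows "state i j = state m j2"
proof (cases "j2 = j")
  case True
  have "m = i"
  proof (rule ccontr)
    assume "m \<noteq> i"
    then have "i < m" using assms(4) True by (auto simp: after_def)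
    then have "(Suc i, j) \<in> D" using D_mono[OF assms(3), of "Suc i" j] True assms(3) by (simp add: mem_D)
    then have "(Suc i, j) \<in> after m j2" using assms(1) by (auto simp: after_def)
    then show False using True \<open>i < m\<close> by (simp add: after_def)
  qed
  then show ?thesis using True by simp
next
  case False
  then have "j < j2" using assms(4) by (auto simp: after_def)
  then have "(1, j2) \<in> after i j" using D_mono[OF assms(3), of 1 j2] assms(3) by (simp add: after_def mem_D)
  then have "m = 0" unfolding assms(1) by (auto simp: after_def)
  have "\<not> cand J j p q" if "i < p" for J p q
  proof
    assume "cand J j p q"
    then have "(p, j) \<in> after i j" using that by (auto simp: cand_def after_def)
    then show False using \<open>j < j2\<close> unfolding assms(1) by (simp add: after_def)
  qed
  moreover have "rev_col T j2 q p (Suc m) = j2" if "T \<in> tabloids lam" "m < p" "cand J j2 p q" for T J p q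
    using rev_col_first_row that cand_ge \<open>m = 0\<close> by simp
  ultimately show ?thesis using assms(1) by (fastforce simp: state_def)
qed

lemma state_initial:
  assumes "after i j = {}"
  shows "state i j = tabloids lam \<times> {J0}"
proof -
  have "\<not> cand J j p q" if "i < p" for J p q
    using that assms by (auto simp: cand_def after_def)
  then show ?thesis by (auto simp: state_def assms increasing_on_def)
qed

lemma stage_bij_step:
  assumes "q < n" "L ! q = (Suc m, j0)"
    and "bij_betw F (tabloids lam \<times> {J0}) (state (Suc m) j0)"
    and "\<And>T. fst (F (T, J0)) = stage (Suc q) T"
  shows "bij_betw (step (Suc m, j0) \<circ> F) (tabloids lam \<times> {J0}) (state m j0)"
    and "fst ((step (Suc m, j0) \<circ> F) (T, J0)) = stage q T"
proof -
  have "(Suc m, j0) \<in> D" using cells_nth_in_D[OF assms(1)] assms(2) by simp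
  then show "bij_betw (step (Suc m, j0) \<circ> F) (tabloids lam \<times> {J0}) (state m j0)"
    using bij_betw_trans[OF assms(3) bij_betw_step] by blast
  show "fst ((step (Suc m, j0) \<circ> F) (T, J0)) = stage q T"
    using assms(4)[of T] stage_Suc[OF assms(1)] assms(2)
    by (cases "F (T, J0)") (simp add: step_def)
qed

text \<open>The step bijections are composed from the last cell on; the first component of the
  composition is the sorting, independently of the bookkeeping.\<close>

lemma stage_bij_before:
  assumes "q < n" "L ! q = (Suc m, j0)"
  shows "\<exists>F. bij_betw F (tabloids lam \<times> {J0}) (state (Suc m) j0) \<and>
     (\<forall>T. fst (F (T, J0)) = stage (Suc q) T)"
  using assms
proof (induction "n - q" arbitrary: q m j0)
  case (Suc d)
  let ?I = "tabloids lam \<times> {J0}"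
  have z: "(Suc m, j0) \<in> D" "set (drop (Suc q) L) = after (Suc m) j0"
    using cells_nth_in_D set_drop_cells Suc.prems by metis+
  show ?case
  proof (cases "Suc q = n")
    case True
    then have "state (Suc m) j0 = ?I" using z(2) length_cells by (intro state_initial) simp
    then have "bij_betw id ?I (state (Suc m) j0)" by simp
    moreover have "fst (id (T, J0)) = stage (Suc q) T" for T
      using True stage_n by simp
    ultimately show ?thesis by blast
  next
    case False
    then have lt: "Suc q < n" using Suc.prems(1) by simp
    then obtain m2 j2 where mj2: "L ! Suc q = (Suc m2, j2)" "(Suc m2, j2) \<in> D"
      "set (drop (Suc q) L) = after m2 j2"
      by (rule cells_nthE)
    have "(Suc m2, j2) \<in> after (Suc m) j0"
      using mj2 z(2) after_Suc[of m2 j2] by simp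
    then have eq: "state (Suc m) j0 = state m2 j2"
      using z mj2 by (intro state_link) auto
    have "d = n - Suc q" using Suc.hyps(2) by simp
    from Suc.hyps(1)[OF this lt mj2(1)] obtain F where F: "bij_betw F ?I (state (Suc m2) j2)"
      "\<And>T. fst (F (T, J0)) = stage (Suc (Suc q)) T" by blast
    show ?thesis unfolding eq using stage_bij_step[OF lt mj2(1) F] by blast
  qed
qed simp

lemma stage_bij:
  assumes "q < n" "L ! q = (Suc m, j0)"
  shows "\<exists>F. bij_betw F (tabloids lam \<times> {J0}) (state m j0) \<and>
     (\<forall>T. fst (F (T, J0)) = stage q T)"
  using stage_bij_before[OF assms] stage_bij_step[OF assms] by metis

lemma stage_state:
  assumes "T \<in> tabloids lam" "q < n" "L ! q = (Suc m, j0)"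
  shows "\<exists>J. (stage (Suc q) T, J) \<in> state (Suc m) j0"
proof -
  obtain F where F: "bij_betw F (tabloids lam \<times> {J0}) (state (Suc m) j0)"
    "\<And>T. fst (F (T, J0)) = stage (Suc q) T"
    using stage_bij_before[OF assms(2,3)] by blast
  have "F (T, J0) \<in> state (Suc m) j0"
    using bij_betwE[OF F(1)] assms(1) by simp
  then show ?thesis using F(2)[of T] by (metis prod.collapse)
qed

text \<open>After the last step the first row is reached, so the condition on reverse paths is
  automatic and the final states are all pairs of a standard tableau and a hook function. The fibre
  over \<open>U\<close> thus has one tabloid for each hook function.\<close>

lemma card_sorted_to:
  assumes "U \<in> syt lam" "0 < n"
  shows "card {T \<in> tabloids lam. stage 0 T = U} = (\<Prod>y\<in>D. hook lam y)"
proof -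
  obtain m j0 where mj: "L ! 0 = (Suc m, j0)" "(Suc m, j0) \<in> D" "set (drop 0 L) = after m j0"
    by (rule cells_nthE[OF assms(2)])
  have all: "after m j0 = D" using mj(3) set_cells by simp
  have "1 \<le> j0" using mj(2) by (simp add: mem_D)
  then have "(1, j0) \<in> D" using D_mono[OF mj(2), of 1 j0] by simp
  then have "(1, j0) \<in> after m j0" using all by simp
  then have m0: "m = 0" by (simp add: after_def)
  let ?H = "\<Pi>\<^sub>E c\<in>D. {- leg c..arm c}"
  have st: "state m j0 = {(T, J). T \<in> syt lam \<and> J \<in> ?H}"
  proof -
    have "\<forall>p q. m < p \<and> cand J j0 p q \<longrightarrow> rev_col T j0 q p (Suc m) = j0"
      if "T \<in> tabloids lam" for T J
    proof (intro allI impI)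
      fix p q assume "m < p \<and> cand J j0 p q"
      then show "rev_col T j0 q p (Suc m) = j0"
        using rev_col_first_row[OF that, of j0 q p] cand_ge[of J j0 p q] m0 by simp
    qed
    then show ?thesis unfolding state_def all syt_eq by blast
  qed
  obtain F where F: "bij_betw F (tabloids lam \<times> {J0}) (state m j0)"
    "\<And>T. fst (F (T, J0)) = stage 0 T"
    using stage_bij[OF assms(2) mj(1)] by blast
  let ?A = "{T \<in> tabloids lam. stage 0 T = U} \<times> {J0}"
  have "F ` ?A = {U} \<times> ?H"
  proof
    show "F ` ?A \<subseteq> {U} \<times> ?H"
    proof
      fix y assume "y \<in> F ` ?A"
      then obtain T where T: "T \<in> tabloids lam" "stage 0 T = U" "y = F (T, J0)" by blast
      then have "y \<in> state m j0" using bij_betwE[OF F(1)] by simp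
      moreover have "fst y = U" using T F(2) by simp
      ultimately show "y \<in> {U} \<times> ?H" by (cases y) (simp add: st)
    qed
    show "{U} \<times> ?H \<subseteq> F ` ?A"
    proof
      fix y assume y: "y \<in> {U} \<times> ?H"
      then have "y \<in> state m j0" using assms(1) by (auto simp: st)
      then obtain T where T: "T \<in> tabloids lam" "y = F (T, J0)"
        using F(1) unfolding bij_betw_def by blast
      then have "stage 0 T = U" using y F(2)[of T] by auto
      then show "y \<in> F ` ?A" using T by blast
    qed
  qed
  moreover have "inj_on F ?A"
    using F(1) by (auto simp: bij_betw_def inj_on_def)
  then have "card (F ` ?A) = card ?A" by (rule card_image)
  ultimately have "card ?A = card ({U} \<times> ?H)" by (simp only:)
  then have "card {T \<in> tabloids lam. stage 0 T = U} = card ?H"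
    by (simp add: card_cartesian_product)
  also have "\<dots> = (\<Prod>c\<in>D. nat (arm c + leg c + 1))"
    by (simp add: card_PiE algebra_simps)
  also have "\<dots> = (\<Prod>y\<in>D. hook lam y)"
    using int_hook by (intro prod.cong) (auto simp flip: int_hook)
  finally show ?thesis .
qed

lemma finite_tabloids: "finite (tabloids lam)" and card_tabloids: "card (tabloids lam) = fact n"
proof -
  have "tabloids lam = {T. bij_betw T D {1..card D} \<and> (\<forall>x. x \<notin> D \<longrightarrow> T x = 0)}"
    by (auto simp: tabloids_iff card_D)
  then show "card (tabloids lam) = fact n"
    using card_bij_betw_zero_outside[OF finite_D] by (simp add: card_D)
  then show "finite (tabloids lam)" by (metis card.infinite fact_nonzero)
qed

lemma stage_0_syt:
  assumes "T \<in> tabloids lam" "0 < n"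
  shows "stage 0 T \<in> syt lam"
proof -
  obtain m j0 where mj: "L ! 0 = (Suc m, j0)" "(Suc m, j0) \<in> D" "set (drop 0 L) = after m j0"
    by (rule cells_nthE[OF assms(2)])
  obtain F where F: "bij_betw F (tabloids lam \<times> {J0}) (state m j0)"
    "\<And>T. fst (F (T, J0)) = stage 0 T"
    using stage_bij[OF assms(2) mj(1)] by blast
  have "F (T, J0) \<in> state m j0"
    using bij_betwE[OF F(1)] assms(1) by simp
  then show ?thesis using F(2)[of T] mj(3) set_cells by (auto simp: state_def syt_eq)
qed

lemma finite_syt: "finite (syt lam)"
  using finite_tabloids by (simp add: syt_eq)

lemma card_sorted_to_set:
  assumes "0 < n"
  shows "card {T \<in> tabloids lam. P (stage 0 T)} = (\<Prod>y\<in>D. hook lam y) * card {U \<in> syt lam. P U}"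
proof -
  have "{T \<in> tabloids lam. P (stage 0 T)} = (\<Union>U\<in>{U \<in> syt lam. P U}. {T \<in> tabloids lam. stage 0 T = U})"
    using stage_0_syt[OF _ assms] by auto
  also have "card \<dots> = (\<Sum>U\<in>{U \<in> syt lam. P U}. card {T \<in> tabloids lam. stage 0 T = U})"
    using finite_syt finite_tabloids by (intro card_UN_disjoint) auto
  also have "\<dots> = (\<Sum>U\<in>{U \<in> syt lam. P U}. \<Prod>y\<in>D. hook lam y)"
    using card_sorted_to[OF _ assms] by (intro sum.cong) auto
  finally show ?thesis by (simp add: mult.commute)
qed

end

section \<open>The drop function\<close>

text \<open>Truncation makes entries that are at least k indistinguishable.\<close>
definition trunc :: "nat \<Rightarrow> filling \<Rightarrow> filling" where
  "trunc k T = (\<lambda>c. min (T c) k)"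

lemma trunc_swap: "k \<le> T c \<Longrightarrow> k \<le> T d \<Longrightarrow> trunc k (T(c := T d, d := T c)) = trunc k T"
  by (auto simp: trunc_def fun_eq_iff)

lemma ge_iff_trunc: "k \<le> T c \<longleftrightarrow> trunc k T c = k"
  by (auto simp: trunc_def)

section \<open>Sorting commutes with truncation\<close>

context partition
begin

definition south_east :: "cell \<Rightarrow> cell set" where
  "south_east c = {d \<in> D. fst c \<le> fst d \<and> snd c \<le> snd d}"

text \<open>A slide only reaches cells to the south-east of its start, so here it exchanges large
  entries among themselves.\<close>

lemma trunc_slide_aux_large:
  "c \<in> D \<Longrightarrow> \<forall>d\<in>south_east c. k \<le> T d \<Longrightarrow> trunc k (slide_aux D f T c) = trunc k T"
proof (induction f arbitrary: T c)
  case (Suc f)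
  have move: "trunc k (slide_aux D f (T(c := T d, d := T c)) d) = trunc k T"
    if "d = (fst c, Suc (snd c)) \<or> d = (Suc (fst c), snd c)" "d \<in> D" for d
  proof -
    have sub: "south_east d \<subseteq> south_east c" "c \<in> south_east c" "d \<in> south_east c" using that Suc.prems(1) by (auto simp: south_east_def)
    then have "\<forall>x\<in>south_east d. k \<le> (T(c := T d, d := T c)) x" using Suc.prems(2) by auto
    then have "trunc k (slide_aux D f (T(c := T d, d := T c)) d) = trunc k (T(c := T d, d := T c))"
      using Suc.IH that(2) by blast
    then show ?thesis using trunc_swap sub Suc.prems(2) by metis
  qed
  show ?case unfolding slide_aux.simps Let_def using move by (simp del: fun_upd_apply)
qed simp

text \<open>While the next exchange brings up an entry below \<open>k\<close>, truncation does not
  alter the decision. Once the moving entry and its neighbours are large, all entries to the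
  south-east are large: the original slide only permutes these, and the truncated one stops, since
  equal entries are not exchanged.\<close>

lemma trunc_slide_aux:
  "c \<in> D \<Longrightarrow> increasing_on (south_east c - {c}) T \<Longrightarrow>
    trunc k (slide_aux D f T c) = slide_aux D f (trunc k T) c"
proof (induction f arbitrary: T c)
  case (Suc f)
  obtain i j where c: "c = (i, j)" by fastforce
  let ?r = "(i, Suc j)" and ?b = "(Suc i, j)"
  have ij: "1 \<le> i" "1 \<le> j" using Suc.prems(1) by (auto simp: c mem_D)
  have move: "trunc k (slide_aux D f (T(c := T d, d := T c)) d)
      = slide_aux D f ((trunc k T)(c := trunc k T d, d := trunc k T c)) d"
    if "d = ?r \<or> d = ?b" "d \<in> D" for d
  proof -
    have sub: "south_east d - {d} \<subseteq> south_east c - {c}" "c \<notin> south_east d - {d}" using that(1) by (auto simp: south_east_def c)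
    then have "increasing_on (south_east d - {d}) (T(c := T d, d := T c))"
      using Suc.prems(2) unfolding increasing_on_def by (smt (verit) Diff_iff fun_upd_other insertCI subsetD)
    moreover have "trunc k (T(c := T d, d := T c)) = (trunc k T)(c := trunc k T d, d := trunc k T c)"
      by (auto simp: trunc_def fun_eq_iff)
    ultimately show ?thesis using Suc.IH[OF that(2)] by (simp only:)
  qed
  show ?case
  proof (cases "k \<le> T c \<and> (?r \<in> D \<longrightarrow> k \<le> T ?r) \<and> (?b \<in> D \<longrightarrow> k \<le> T ?b)")
    case True
    have "k \<le> T d" if d: "d \<in> south_east c" for d
    proof -
      obtain i' j' where d': "d = (i', j')" "d \<in> D" "i \<le> i'" "j \<le> j'"
        using d by (cases d) (auto simp: south_east_def c)
      have rect: "(a, b) \<in> south_east c - {c}"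
        if "i \<le> a" "a \<le> i'" "j \<le> b" "b \<le> j'" "(a, b) \<noteq> (i, j)" for a b
        using that D_mono[of i' j' a b] d' ij by (auto simp: south_east_def c)
      consider "d = c" | "j < j'" | "i < i'" using d' c by fastforce
      then show ?thesis
      proof cases
        case 2
        then have "?r \<in> D" using D_mono[of i' j' i "Suc j"] d' ij by simp
        moreover have "T ?r \<le> T (i', j')"
          using 2 d' by (intro increasing_on_mono[OF Suc.prems(2)] rect) auto
        ultimately show ?thesis using True d' by simp
      next
        case 3
        then have "?b \<in> D" using D_mono[of i' j' "Suc i" j] d' ij by simp
        moreover have "T ?b \<le> T (i', j')"
          using 3 d' by (intro increasing_on_mono[OF Suc.prems(2)] rect) auto
        ultimately show ?thesis using True d' by simp
      qed (use True in simp)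
    qed
    then have "trunc k (slide_aux D (Suc f) T c) = trunc k T"
      using trunc_slide_aux_large Suc.prems(1) by blast
    moreover have "slide_aux D (Suc f) (trunc k T) c = trunc k T"
      using True by (auto simp: c trunc_def Let_def)
    ultimately show ?thesis by simp
  next
    case False
    then consider
        (stop) "\<not> (?r \<in> D \<and> T ?r < T c)" "\<not> (?b \<in> D \<and> T ?b < T c)"
      | (right) "?r \<in> D" "T ?r < T c" "T ?r < k" "?b \<in> D \<and> T ?b < T c \<Longrightarrow> T ?r < T ?b"
      | (down) "?b \<in> D" "T ?b < T c" "T ?b < k" "?r \<in> D \<and> T ?r < T c \<Longrightarrow> \<not> T ?r < T ?b"
      by fastforce
    then show ?thesis
    proof cases
      case stop
      then have "\<not> (?r \<in> D \<and> trunc k T ?r < trunc k T c)" "\<not> (?b \<in> D \<and> trunc k T ?b < trunc k T c)"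
        by (auto simp: trunc_def)
      with stop show ?thesis by (simp add: c Let_def)
    next
      case right
      then have "trunc k T ?r < trunc k T c"
        "?b \<in> D \<and> trunc k T ?b < trunc k T c \<Longrightarrow> trunc k T ?r < trunc k T ?b"
        by (auto simp: trunc_def)
      moreover have "slide_aux D (Suc f) T c = slide_aux D f (T(c := T ?r, ?r := T c)) ?r"
        using right by (auto simp: c Let_def simp del: fun_upd_apply)
      ultimately show ?thesis
        using move[of ?r] right(1) by (auto simp: c Let_def simp del: fun_upd_apply)
    next
      case down
      then have "trunc k T ?b < trunc k T c"
        "?r \<in> D \<and> trunc k T ?r < trunc k T c \<Longrightarrow> \<not> trunc k T ?r < trunc k T ?b"
        by (auto simp: trunc_def)
      moreover have "slide_aux D (Suc f) T c = slide_aux D f (T(c := T ?b, ?b := T c)) ?b"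
        using down by (auto simp: c Let_def simp del: fun_upd_apply)
      ultimately show ?thesis
        using move[of ?b] down(1) by (auto simp: c Let_def simp del: fun_upd_apply)
    qed
  qed
qed simp

lemma stage_Suc_facts:
  assumes "T \<in> tabloids lam" "q < n" "L ! q = (Suc m, j0)"
  shows "stage (Suc q) T \<in> tabloids lam" "increasing_on (after (Suc m) j0) (stage (Suc q) T)"
  using stage_state[OF assms] by (auto simp: state_def)

lemma trunc_stage:
  assumes "T \<in> tabloids lam" "q \<le> n"
  shows "trunc k (stage q T) = stage q (trunc k T)"
  using assms(2)
proof (induction q rule: inc_induct)
  case base
  then show ?case by (simp add: stage_n)
next
  case (step q)
  obtain m j0 where mj: "L ! q = (Suc m, j0)" "(Suc m, j0) \<in> D"
    by (rule cells_nthE[OF step.hyps(2)])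
  have sub: "south_east (Suc m, j0) - {(Suc m, j0)} \<subseteq> after (Suc m) j0"
    by (auto simp: south_east_def after_def)
  have "increasing_on (south_east (Suc m, j0) - {(Suc m, j0)}) (stage (Suc q) T)"
    using stage_Suc_facts(2)[OF assms(1) step.hyps(2) mj(1)] sub unfolding increasing_on_def by blast
  then have "trunc k (slide lam (stage (Suc q) T) (L ! q)) = slide lam (trunc k (stage (Suc q) T)) (L ! q)"
    unfolding slide_def mj(1) by (rule trunc_slide_aux[OF mj(2)])
  then show ?case using step.IH stage_Suc[OF step.hyps(2)] by simp
qed

text \<open>The properties of a slide that matter for the drop function: \<open>A\<close> is its
  path and \<open>e\<close> its end, and all entries on the path other than the moving one are
  smaller than it.\<close>

lemma stage_pathE:
  assumes "T \<in> tabloids lam" "q < n"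
  obtains A e where "L ! q \<in> A" "e \<in> A" "A \<subseteq> set (drop q L)" "stage q T e = stage (Suc q) T (L ! q)"
    "\<forall>c\<in>A - {L ! q}. stage (Suc q) T c < stage (Suc q) T (L ! q)"
    "\<forall>c\<in>A - {e}. stage q T c < stage (Suc q) T (L ! q)"
    "\<forall>c. c \<notin> A \<longrightarrow> stage q T c = stage (Suc q) T c"
proof -
  obtain m j0 where mj: "L ! q = (Suc m, j0)" "(Suc m, j0) \<in> D"
    "set (drop q L) = after m j0" "set (drop (Suc q) L) = after (Suc m) j0"
    by (rule cells_nthE[OF assms(2)])
  obtain J where J: "(stage (Suc q) T, J) \<in> state (Suc m) j0"
    using stage_state[OF assms mj(1)] by blast
  obtain p s where F: "forward_step lam n (stage (Suc q) T) J m j0 p s"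
    by (rule forward_stepI[OF J mj(2)])
  interpret forward_step lam n "stage (Suc q) T" J m j0 p s by (rule F)
  have eq: "stage q T = T'"
    using stage_Suc[OF assms(2)] slide_eq_shift_path[OF path mj(2)] mj(1) by simp
  show ?thesis
  proof (rule that[of "{c. on_path i0 p s c}" "(p, s (Suc p))"])
    show "L ! q \<in> {c. on_path i0 p s c}" using P(1,2) P(3)[of i0] mj(1) by (simp add: on_path_def)
    show "(p, s (Suc p)) \<in> {c. on_path i0 p s c}" using P(1) P(3)[of p] by (simp add: on_path_def)
    show "{c. on_path i0 p s c} \<subseteq> set (drop q L)" using on_pathD(3) W_eq mj(3) by auto
    show "stage q T (p, s (Suc p)) = stage (Suc q) T (L ! q)" using eq T'_end mj(1) by simp
    show "\<forall>c\<in>{c. on_path i0 p s c} - {L ! q}. stage (Suc q) T c < stage (Suc q) T (L ! q)"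
      using on_path_less mj(1) by auto
    show "\<forall>c. c \<notin> {c. on_path i0 p s c} \<longrightarrow> stage q T c = stage (Suc q) T c"
      using T'_off eq by simp
    show "\<forall>c\<in>{c. on_path i0 p s c} - {(p, s (Suc p))}. stage q T c < stage (Suc q) T (L ! q)"
    proof
      fix c assume c: "c \<in> {c. on_path i0 p s c} - {(p, s (Suc p))}"
      obtain i j where ij: "c = (i, j)" by fastforce
      have "on_path i0 p s (i, j)" using c ij by simp
      then show "stage q T c < stage (Suc q) T (L ! q)"
      proof (cases rule: on_path_cases)
        case right
        then show ?thesis using T'_right P(5) eq mj(1) ij by simp
      next
        case down
        then show ?thesis using T'_down P(8) eq mj(1) ij by simp
      qed (use c ij in simp)
    qed
  qed
qed

lemma stage_unprocessed:
  assumes "T \<in> tabloids lam" "q \<le> n" "c \<notin> set (drop q L)"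
  shows "stage q T c = T c"
  using assms(2,3)
proof (induction q rule: inc_induct)
  case base
  then show ?case by (simp add: stage_n)
next
  case (step q)
  have "drop q L = L ! q # drop (Suc q) L"
    using step.hyps length_cells by (simp add: Cons_nth_drop_Suc)
  then have "c \<notin> set (drop (Suc q) L)" using step.prems by simp
  then have "stage (Suc q) T c = T c" by (rule step.IH)
  moreover obtain A where "A \<subseteq> set (drop q L)" "\<forall>c. c \<notin> A \<longrightarrow> stage q T c = stage (Suc q) T c"
    using stage_pathE[OF assms(1) step.hyps(2)] by metis
  ultimately show ?case using step.prems by (metis subsetD)
qed

section \<open>The growth of the set of large cells\<close>

definition large :: "nat \<Rightarrow> filling \<Rightarrow> nat \<Rightarrow> cell set" where
  "large k T q = {c \<in> set (drop q L). k \<le> stage q T c}"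

lemma drop_cells: "q < n \<Longrightarrow> set (drop q L) = insert (L ! q) (set (drop (Suc q) L)) \<and> L ! q \<notin> set (drop (Suc q) L)"
  using Cons_nth_drop_Suc[of q L] distinct_cells length_cells
  by (metis distinct.simps(2) distinct_drop list.simps(15))

lemma stage_next: "T \<in> tabloids lam \<Longrightarrow> q < n \<Longrightarrow> stage (Suc q) T (L ! q) = T (L ! q)"
  using stage_unprocessed[of T "Suc q" "L ! q"] drop_cells by simp

text \<open>No entry on the path exceeds the moving one, so before and after the slide all of them
  are below \<open>k\<close>.\<close>

lemma large_less:
  assumes "T \<in> tabloids lam" "q < n" "T (L ! q) < k"
  shows "large k T q = large k T (Suc q)"
proof -
  obtain A e where A: "L ! q \<in> A" "e \<in> A" "A \<subseteq> set (drop q L)" "stage q T e = stage (Suc q) T (L ! q)"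
    "\<forall>c\<in>A - {L ! q}. stage (Suc q) T c < stage (Suc q) T (L ! q)"
    "\<forall>c\<in>A - {e}. stage q T c < stage (Suc q) T (L ! q)"
    "\<forall>c. c \<notin> A \<longrightarrow> stage q T c = stage (Suc q) T c"
    by (rule stage_pathE[OF assms(1,2)])
  have lt: "stage (Suc q) T (L ! q) < k" using stage_next assms by simp
  have "k \<le> stage q T c \<longleftrightarrow> k \<le> stage (Suc q) T c" for c
  proof (cases "c \<in> A")
    case True
    have "stage q T c < k" using A(4,6) True lt by (cases "c = e") (auto intro: less_trans)
    moreover have "stage (Suc q) T c < k" using A(5) True lt by (cases "c = L ! q") (auto intro: less_trans)
    ultimately show ?thesis by simp
  qed (simp add: A(7))
  then show ?thesis using drop_cells[OF assms(2)] lt by (auto simp: large_def)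
qed

text \<open>The other entries on the path are below \<open>k\<close> and the starting cell was
  unprocessed, so no cell of the path was large before, and afterwards only its end is.\<close>

lemma large_eq:
  assumes "T \<in> tabloids lam" "q < n" "T (L ! q) = k" "x \<in> D"
  shows "x \<in> large k T q - large k T (Suc q) \<longleftrightarrow> stage q T x = k"
    and "large k T (Suc q) \<subseteq> large k T q"
proof -
  obtain A e where A: "L ! q \<in> A" "e \<in> A" "A \<subseteq> set (drop q L)" "stage q T e = stage (Suc q) T (L ! q)"
    "\<forall>c\<in>A - {L ! q}. stage (Suc q) T c < stage (Suc q) T (L ! q)"
    "\<forall>c\<in>A - {e}. stage q T c < stage (Suc q) T (L ! q)"
    "\<forall>c. c \<notin> A \<longrightarrow> stage q T c = stage (Suc q) T c"
    by (rule stage_pathE[OF assms(1,2)])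
  have k: "stage (Suc q) T (L ! q) = k" using stage_next assms by simp
  note dr = drop_cells[OF assms(2)]
  have old: "c \<notin> large k T (Suc q)" if "c \<in> A" for c
  proof (cases "c = L ! q")
    case False
    then have "stage (Suc q) T c < k" using A(5) that k by blast
    then show ?thesis by (simp add: large_def)
  qed (use dr in \<open>simp add: large_def\<close>)
  have new: "c \<in> large k T q \<longleftrightarrow> c = e" if "c \<in> A" for c
  proof (cases "c = e")
    case False
    then have "stage q T c < k" using A(6) that k by blast
    then show ?thesis using False by (simp add: large_def)
  qed (use A(2,3,4) k in \<open>auto simp: large_def\<close>)
  have same: "c \<in> large k T q \<longleftrightarrow> c \<in> large k T (Suc q)" if "c \<notin> A" for c
  proof -
    have "c \<noteq> L ! q" using A(1) that by blast
    then show ?thesis using that dr by (simp add: large_def A(7))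
  qed
  show "large k T (Suc q) \<subseteq> large k T q" using old same by blast
  have e: "e \<in> D" using A(2,3) set_cells set_drop_subset[of q L] by blast
  obtain m j0 where mj: "L ! q = (Suc m, j0)" "(Suc m, j0) \<in> D"
    by (rule cells_nthE[OF assms(2)])
  have "stage q T \<in> tabloids lam"
    using slide_tabloid[OF stage_Suc_facts(1)[OF assms(1,2) mj(1)] mj(2)] stage_Suc[OF assms(2)] mj(1)
    by simp
  then have "inj_on (stage q T) D" by (rule tabloid_inj)
  then have "stage q T x = stage q T e \<longleftrightarrow> x = e"
    using assms(4) e by (rule inj_on_eq_iff)
  then have "stage q T x = k \<longleftrightarrow> x = e" using A(4) k by simp
  then show "x \<in> large k T q - large k T (Suc q) \<longleftrightarrow> stage q T x = k"
    using old new same A(2) by blast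
qed

lemma large_trunc:
  assumes "T \<in> tabloids lam" "T2 \<in> tabloids lam" "trunc k T = trunc k T2" "q \<le> n"
  shows "large k T q = large k T2 q"
proof -
  have "trunc k (stage q T) = trunc k (stage q T2)"
    using trunc_stage assms by simp
  then have "k \<le> stage q T c \<longleftrightarrow> k \<le> stage q T2 c" for c by (metis ge_iff_trunc)
  then show ?thesis by (simp add: large_def)
qed

lemma swap_values:
  assumes "T \<in> tabloids lam" "1 \<le> k" "k \<le> m" "m \<le> n"
  shows "transpose k m \<circ> T \<in> tabloids lam" "trunc k (transpose k m \<circ> T) = trunc k T"
proof -
  have "bij_betw (transpose k m \<circ> T) D {1..n}"
    using assms by (intro bij_betw_trans[of T D "{1..n}"]) (auto simp: tabloids_iff)
  then show "transpose k m \<circ> T \<in> tabloids lam"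
    using assms by (auto simp: tabloids_iff transpose_def)
  show "trunc k (transpose k m \<circ> T) = trunc k T"
    using assms(3) by (auto simp: trunc_def transpose_def fun_eq_iff)
qed

text \<open>Exchanging the values \<open>k\<close> and \<open>T (L ! q)\<close> is invisible to
  truncation and hence to \<open>large\<close>; this reduces a large moving entry to the case of
  \<open>large_eq\<close>.\<close>

lemma large_antimono:
  assumes "T \<in> tabloids lam" "1 \<le> k" "q < n"
  shows "large k T (Suc q) \<subseteq> large k T q"
proof (cases "T (L ! q) < k")
  case True
  then show ?thesis using large_less assms by simp
next
  case False
  let ?m = "T (L ! q)"
  have m: "?m \<le> n"
    using assms cells_nth_in_D[OF assms(3)] bij_betwE[of T D "{1..n}"] by (auto simp: tabloids_iff)
  let ?T = "transpose k ?m \<circ> T"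
  have T: "?T \<in> tabloids lam" "trunc k ?T = trunc k T"
    using swap_values assms False m by auto
  have "large k ?T (Suc q) \<subseteq> large k ?T q"
    using large_eq(2)[OF T(1) assms(3) _ cells_nth_in_D[OF assms(3)], of k] by simp
  then show ?thesis using large_trunc[OF T(1) assms(1) T(2)] assms(3) by simp
qed

text \<open>The tabloids are sorted by their entry in \<open>L ! q\<close>. Entries below
  \<open>k\<close> contribute nothing, and exchanging the values \<open>k\<close> and
  \<open>m\<close> shows that the remaining classes, one for each \<open>m\<close> from
  \<open>k\<close> to \<open>n\<close>, are equally large.\<close>

lemma card_new_large:
  assumes "1 \<le> k" "k \<le> n" "q < n" "x \<in> D"
  shows "card {T \<in> tabloids lam. x \<in> large k T q - large k T (Suc q)}
    = (n - k + 1) * card {T \<in> tabloids lam. T (L ! q) = k \<and> stage q T x = k}"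
proof -
  let ?N = "\<lambda>T. x \<in> large k T q - large k T (Suc q)"
  let ?S = "\<lambda>m. {T \<in> tabloids lam. T (L ! q) = m \<and> ?N T}"
  have N: "?N T \<longleftrightarrow> ?N T2" if "T \<in> tabloids lam" "T2 \<in> tabloids lam" "trunc k T = trunc k T2" for T T2
    using large_trunc[OF that] assms(3) by simp
  have "T (L ! q) \<in> {k..n}" if "T \<in> tabloids lam" "?N T" for T
  proof -
    have "\<not> T (L ! q) < k" using large_less[OF that(1) assms(3)] that(2) by blast
    moreover have "T (L ! q) \<in> {1..n}"
      using that(1) cells_nth_in_D[OF assms(3)] unfolding tabloids_iff by (blast dest: bij_betwE)
    ultimately show ?thesis by simp
  qed
  then have "{T \<in> tabloids lam. ?N T} = (\<Union>m\<in>{k..n}. ?S m)" by blast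
  also have "card \<dots> = (\<Sum>m\<in>{k..n}. card (?S m))"
    using finite_tabloids by (intro card_UN_disjoint) auto
  also have "\<dots> = (\<Sum>m\<in>{k..n}. card (?S k))"
  proof (rule sum.cong[OF refl])
    fix m assume m: "m \<in> {k..n}"
    have sw: "transpose k m \<circ> T \<in> tabloids lam" "?N (transpose k m \<circ> T) \<longleftrightarrow> ?N T"
      if "T \<in> tabloids lam" for T
      using swap_values[OF that assms(1), of m] m N[OF _ that, of "transpose k m \<circ> T"] by auto
    have "bij_betw (\<lambda>T. transpose k m \<circ> T) (?S m) (?S k)"
    proof (rule bij_betw_byWitness[where f' = "\<lambda>T. transpose k m \<circ> T"])
      show "\<forall>T\<in>?S m. transpose k m \<circ> (transpose k m \<circ> T) = T"
        and "\<forall>T\<in>?S k. transpose k m \<circ> (transpose k m \<circ> T) = T"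
        by (simp_all add: comp_assoc[symmetric])
      show "(\<lambda>T. transpose k m \<circ> T) ` ?S m \<subseteq> ?S k" "(\<lambda>T. transpose k m \<circ> T) ` ?S k \<subseteq> ?S m"
        using sw by auto
    qed
    then show "card (?S m) = card (?S k)" by (rule bij_betw_same_card)
  qed
  also have "\<dots> = (n - k + 1) * card (?S k)" using assms(2) by (simp add: Suc_diff_le)
  also have "?S k = {T \<in> tabloids lam. T (L ! q) = k \<and> stage q T x = k}"
    using large_eq(1) assms(3,4) by blast
  finally show ?thesis .
qed

lemma drop_fun_eq:
  assumes "1 \<le> k" "k \<le> n"
  shows "drop_fun lam k x = (\<Sum>q<n. card {T \<in> tabloids lam. T (L ! q) = k \<and> stage q T x = k})"
proof -
  let ?S = "\<lambda>q. {T \<in> tabloids lam. T (L ! q) = k \<and> stage q T x = k}"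
  have pos: "(THE z. z \<in> D \<and> T z = k) = L ! q" if "T \<in> tabloids lam" "q < n" "T (L ! q) = k" for T q
    using that cells_nth_in_D[OF that(2)] inj_onD[OF tabloid_inj[OF that(1)]]
    by (intro the_equality) auto
  have ex: "\<exists>q<n. T (L ! q) = k" if T: "T \<in> tabloids lam" for T
  proof -
    have "k \<in> T ` D" using T assms by (simp add: tabloids_iff bij_betw_def)
    then obtain z where "z \<in> set L" "T z = k" using set_cells by auto
    then show ?thesis using length_cells by (metis in_set_conv_nth)
  qed
  have "{T \<in> tabloids lam. let z = (THE z. z \<in> D \<and> T z = k) in nps_at lam T z x = k} = (\<Union>q<n. ?S q)"
  proof (intro set_eqI iffI)
    fix T assume T: "T \<in> {T \<in> tabloids lam. let z = (THE z. z \<in> D \<and> T z = k) in nps_at lam T z x = k}"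
    then obtain q where q: "q < n" "T (L ! q) = k" using ex by blast
    then have "stage q T x = k" using T pos[of T q] nps_at_eq[of q T] by (simp add: Let_def)
    then show "T \<in> (\<Union>q<n. ?S q)" using T q by blast
  next
    fix T assume "T \<in> (\<Union>q<n. ?S q)"
    then obtain q where q: "q < n" "T \<in> tabloids lam" "T (L ! q) = k" "stage q T x = k" by blast
    then show "T \<in> {T \<in> tabloids lam. let z = (THE z. z \<in> D \<and> T z = k) in nps_at lam T z x = k}"
      using pos[of T q] nps_at_eq[of q T] by (simp add: Let_def)
  qed
  also have "card (\<Union>q<n. ?S q) = (\<Sum>q<n. card (?S q))"
  proof (rule card_UN_disjoint)
    show "\<forall>q\<in>{..<n}. \<forall>q'\<in>{..<n}. q \<noteq> q' \<longrightarrow> ?S q \<inter> ?S q' = {}"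
    proof (intro ballI impI)
      fix q q' assume h: "q \<in> {..<n}" "q' \<in> {..<n}" "q \<noteq> q'"
      then have ne: "L ! q \<noteq> L ! q'" using distinct_cells length_cells by (simp add: nth_eq_iff_index_eq)
      have "L ! q \<in> D" "L ! q' \<in> D" using cells_nth_in_D h by auto
      then show "?S q \<inter> ?S q' = {}" using ne inj_onD[OF tabloid_inj, of _ "L ! q" "L ! q'"] by fastforce
    qed
  qed (use finite_tabloids in auto)
  finally show ?thesis by (simp add: drop_fun_def)
qed

text \<open>The new large cells telescope: x becomes large at exactly one slide or at none.\<close>
lemma drop_fun_sorted:
  assumes "1 \<le> k" "k \<le> n" "x \<in> D"
  shows "(n - k + 1) * drop_fun lam k x = card {T \<in> tabloids lam. k \<le> stage 0 T x}"
proof -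
  \<comment> \<open>Integer indicators: by \<open>large_antimono\<close> the indicator of the set
    difference is a difference of indicators, so the sum over all cells telescopes.\<close>
  let ?b = "\<lambda>T q. of_bool (x \<in> large k T q) :: int"
  have "int ((n - k + 1) * drop_fun lam k x)
      = (\<Sum>q<n. int (card {T \<in> tabloids lam. x \<in> large k T q - large k T (Suc q)}))"
    using card_new_large[OF assms(1,2) _ assms(3)] drop_fun_eq[OF assms(1,2)]
    by (simp add: sum_distrib_left)
  also have "\<dots> = (\<Sum>q<n. \<Sum>T\<in>tabloids lam. ?b T q - ?b T (Suc q))"
  proof (rule sum.cong[OF refl])
    fix q assume q: "q \<in> {..<n}"
    have "int (card {T \<in> tabloids lam. x \<in> large k T q - large k T (Suc q)})
        = (\<Sum>T\<in>tabloids lam. of_bool (x \<in> large k T q - large k T (Suc q)))"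
      using finite_tabloids by (simp add: sum_of_bool_eq Int_def)
    also have "\<dots> = (\<Sum>T\<in>tabloids lam. ?b T q - ?b T (Suc q))"
      using large_antimono[OF _ assms(1)] q by (intro sum.cong) (auto simp: of_bool_def)
    finally show "int (card {T \<in> tabloids lam. x \<in> large k T q - large k T (Suc q)})
        = (\<Sum>T\<in>tabloids lam. ?b T q - ?b T (Suc q))" .
  qed
  also have "\<dots> = (\<Sum>T\<in>tabloids lam. \<Sum>q<n. ?b T q - ?b T (Suc q))"
    by (rule sum.swap)
  also have "\<dots> = (\<Sum>T\<in>tabloids lam. ?b T 0)"
  proof (rule sum.cong[OF refl])
    fix T
    have "large k T n = {}" using length_cells by (simp add: large_def)
    then show "(\<Sum>q<n. ?b T q - ?b T (Suc q)) = ?b T 0"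
      using sum_lessThan_telescope'[of "?b T" n] by simp
  qed
  also have "\<dots> = int (card {T \<in> tabloids lam. k \<le> stage 0 T x})"
    using finite_tabloids assms(3) set_cells by (simp add: sum_of_bool_eq Int_def large_def)
  finally show ?thesis by linarith
qed

section \<open>From sorted tabloids to counts of standard tableaux\<close>

lemma card_syt_ge:
  assumes "x \<in> D"
  shows "card {U \<in> syt lam. k \<le> U x} = (\<Sum>l = k..n. f_syt_at lam l x)"
proof -
  have "U x \<le> n" if "U \<in> syt lam" for U
    using that assms bij_betwE[of U D "{1..n}"] by (auto simp: syt_eq tabloids_iff)
  then have "{U \<in> syt lam. k \<le> U x} = (\<Union>l\<in>{k..n}. {U \<in> syt lam. U x = l})" by auto
  also have "card \<dots> = (\<Sum>l\<in>{k..n}. card {U \<in> syt lam. U x = l})"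
    using finite_syt by (intro card_UN_disjoint) auto
  finally show ?thesis by (simp add: f_syt_at_def)
qed

lemma hook_length_formula: "0 < n \<Longrightarrow> (\<Prod>y\<in>D. hook lam y) * f_syt lam = fact n"
  using card_sorted_to_set[of "\<lambda>_. True"] card_tabloids by (simp add: f_syt_def)

lemma drop_fun_hooks:
  assumes "1 \<le> k" "k \<le> n" "x \<in> D"
  shows "(n - k + 1) * drop_fun lam k x = (\<Prod>y\<in>D. hook lam y) * (\<Sum>l = k..n. f_syt_at lam l x)"
  using drop_fun_sorted[OF assms] card_sorted_to_set[of "\<lambda>U. k \<le> U x"] card_syt_ge[OF assms(3)] assms
  by simp

lemma sum_f_syt_at:
  assumes "1 \<le> k" "k \<le> n" "x \<in> D"
  shows "(\<Sum>l = 1..k - 1. f_syt_at lam l x) + (\<Sum>l = k..n. f_syt_at lam l x) = f_syt lam"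
proof -
  have "1 \<le> U x" if "U \<in> syt lam" for U
    using that assms bij_betwE[of U D "{1..n}"] by (auto simp: syt_eq tabloids_iff)
  then have "{U \<in> syt lam. 1 \<le> U x} = syt lam" by blast
  then have "f_syt lam = (\<Sum>l = 1..n. f_syt_at lam l x)"
    using card_syt_ge[OF assms(3), of 1] by (simp add: f_syt_def)
  also have "{1..n} = {1..k - 1} \<union> {k..n}" using assms by auto
  also have "(\<Sum>l\<in>\<dots>. f_syt_at lam l x)
      = (\<Sum>l = 1..k - 1. f_syt_at lam l x) + (\<Sum>l = k..n. f_syt_at lam l x)"
    by (rule sum.union_disjoint) auto
  finally show ?thesis by simp
qed

end

theorem theorem3:
  fixes n k :: nat and lam :: "nat list" and x :: cell
  assumes "1 \<le> k" "k \<le> n" "is_partition n lam" "x \<in> diagram lam"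
  shows "real (drop_fun lam k x)
           = fact n / (real n - real k + 1)
             * (1 - (\<Sum>l = 1..k - 1. real (f_syt_at lam l x) / real (f_syt lam)))
       \<and> real (drop_fun lam k x)
           = (\<Prod>y \<in> diagram lam. real (hook lam y)) / (real n - real k + 1)
             * (\<Sum>l = k..n. real (f_syt_at lam l x))"
proof -
  interpret partition lam n by unfold_locales (rule assms(3))
  let ?d = "real n - real k + 1" and ?H = "\<Prod>y \<in> diagram lam. real (hook lam y)"
  let ?B = "\<Sum>l = k..n. real (f_syt_at lam l x)" and ?A = "\<Sum>l = 1..k - 1. real (f_syt_at lam l x)"
  have d_eq: "real (n - k + 1) = ?d" using assms(2) by simp
  have "real ((n - k + 1) * drop_fun lam k x)
      = real ((\<Prod>y \<in> diagram lam. hook lam y) * (\<Sum>l = k..n. f_syt_at lam l x))"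
    using drop_fun_hooks[OF assms(1,2,4)] by simp
  then have drop: "?d * real (drop_fun lam k x) = ?H * ?B"
    by (simp only: of_nat_mult of_nat_prod of_nat_sum d_eq)
  have "real ((\<Prod>y\<in>diagram lam. hook lam y) * f_syt lam) = real (fact n)"
    using hook_length_formula assms(1,2) by simp
  then have hlf: "?H * real (f_syt lam) = fact n" by simp
  \<comment> \<open>By the hook length formula the number of standard tableaux divides a factorial,
    so division by it is legitimate.\<close>
  then have f: "real (f_syt lam) \<noteq> 0" by (metis fact_nonzero mult_zero_right)
  have "real ((\<Sum>l = 1..k - 1. f_syt_at lam l x) + (\<Sum>l = k..n. f_syt_at lam l x)) = real (f_syt lam)"
    using sum_f_syt_at[OF assms(1,2,4)] by simp
  then have AB: "?A + ?B = real (f_syt lam)" by simp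
  have d: "?d > 0" using assms(2) by simp
  have second: "real (drop_fun lam k x) = ?H / ?d * ?B"
    using drop d by (simp add: field_simps)
  have "1 - (\<Sum>l = 1..k - 1. real (f_syt_at lam l x) / real (f_syt lam)) = 1 - ?A / real (f_syt lam)"
    by (simp add: sum_divide_distrib)
  also have "\<dots> = ?B / real (f_syt lam)" using AB f by (simp add: field_simps)
  finally have "fact n / ?d * (1 - (\<Sum>l = 1..k - 1. real (f_syt_at lam l x) / real (f_syt lam)))
      = ?H / ?d * ?B"
    using f by (simp add: hlf[symmetric])
  then show ?thesis using second by (metis (no_types))
qed

end
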